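(* Let $\check R_1$ be a Yang--Baxter operator on $V^{\pi_1}$, let $\Sigma_{\pi_2}$ be a connecting system for $\pi_2$, and let $j\in\Gamma(\pi\times\pi,\overline{\operatorname{Hom}}(V^{\pi_2}\otimes V^{\pi_2},V^{\pi_1}\otimes V^{\pi_1}))$ be right invertible. Suppose that the connecting system for $\pi_2$ is quasi-unique and that there is no multi-edge in $\pi$. If $j$ is a twist for this quasi-unique connecting system, then $(\check R_2)_\lhd$ is a Yang--Baxter operator on $V^{\pi_2}$.
   Context: The ground field is $k=\mathbb C$. $\pi_1,\pi_2$ are groupoids and $V^{\pi_i}=(V^{\pi_i}_\alpha)_{\alpha\in\pi_i}$ is a $\pi_i$-graded vector space of finite type: each $V^{\pi_i}_\alpha$ is finite dimensional, and for each object $a$ only finitely many arrows $\alpha$ with source or target $a$ have $V^{\pi_i}_\alpha\neq0$. Tensor products are $(V\otimes W)_\gamma=\bigoplus_{\beta\circ\alpha=\gamma}V_\alpha\otimes W_\beta$ ($\beta\circ\alpha$: first $\alpha$, then $\beta$); $\operatorname{End}$ denotes degree-preserving endomorphisms. A Yang--Baxter operator on $V$ is a meromorphic function $z\mapsto\check R(z)\in\operatorname{End}(V\otimes V)$ of $z\in\mathbb C$ satisfying the Yang--Baxter equation $\check R(z-w)^{(23)}\check R(z)^{(12)}\check R(w)^{(23)}=\check R(w)^{(12)}\check R(z)^{(23)}\check R(z-w)^{(12)}$ on $V^{\otimes 3}$ (superscripts: tensor factors acted on) and the inversion relation $\check R(z)\check R(-z)=\mathrm{id}_{V\otimes V}$.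 $\pi$ is a set with surjective maps $s_\pi:\pi\to\mathrm{Ob}(\pi_1)$, $t_\pi:\pi\to\mathrm{Ob}(\pi_2)$; its elements are viewed as arrows from $\pi_1$ to $\pi_2$. No multi-edge means at most one element of $\pi$ with given source and target. Transfer operators: for $V=(V^{\pi_1})^{\otimes m}$, $W=(V^{\pi_2})^{\otimes m}$, $\Gamma(\pi\times\pi,\overline{\operatorname{Hom}}(W,V))$ is the set of maps $g$ on $\pi\times\pi$ with $g(\beta_1,\beta_2)\in\bigoplus\operatorname{Hom}(W_\gamma,V_\alpha)$, over $\gamma\in\pi_2(t_\pi(\beta_1),t_\pi(\beta_2))$, $\alpha\in\pi_1(s_\pi(\beta_1),s_\pi(\beta_2))$, and $\Gamma(\pi\times\pi,\overline{\operatorname{Hom}}(V,W))$ is the set of maps $f$ with $f(\beta_1,\beta_2)\in\bigoplus\operatorname{Hom}(V_\alpha,W_\gamma)$, over $\alpha\in\pi_1(s_\pi(\beta_2),s_\pi(\beta_1))$, $\gamma\in\pi_2(t_\pi(\beta_2),t_\pi(\beta_1))$; in both cases, for every $\beta_1,\beta_2$ the number of $\alpha,\gamma$ is finite. An operator $Q\in\operatorname{End}(V)$ acts by $(Qg)(\beta_1,\beta_2)=Q\circ g(\beta_1,\beta_2)$. Fusion: $(g*_\otimes g')(\beta_1,\beta_2)=\sum_\beta g(\beta_1,\beta)\otimes g'(\beta,\beta_2)$. The map $g$ is right invertible with inverse $g^{-1}\in\Gamma(\pi\times\pi,\overline{\operatorname{Hom}}(V,W))$ if $\sum_\beta g(\beta,\beta_2)g^{-1}(\beta_1,\beta)=\delta_{\beta_1,\beta_2}\mathrm{id}_{g^{-1}}(\beta_1,\beta_1)$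 for $t_\pi(\beta_1)=t_\pi(\beta_2)$, where $\mathrm{id}_{g^{-1}}(\beta_1,\beta_1)$ is the identity on $V_\alpha$ for any $V_\alpha$ that $g^{-1}$ transfers along $\beta_1$, i.e. on which $g^{-1}(\beta_1,\cdot)$ acts. It is left invertible if there is $g^{-1}$ with $\sum_\beta g^{-1}(\beta,\beta_2)g(\beta_1,\beta)=\delta_{\beta_1,\beta_2}\mathrm{id}_{g}(\beta_1,\beta_1)$ for $s_\pi(\beta_1)=s_\pi(\beta_2)$, where $\mathrm{id}_g(\beta_1,\beta_1)$ is the identity on any $W_\gamma$ that $g$ transfers along $\beta_1$. It is invertible if both hold with the same $g^{-1}$. Write $(g^{-1}*_\circ h)(\beta_1,\beta_2):=\sum_\beta g^{-1}(\beta,\beta_2)h(\beta_1,\beta)$ for $h\in\Gamma(\pi\times\pi,\overline{\operatorname{Hom}}(W,V))$ and $s_\pi(\beta_1)=s_\pi(\beta_2)$. In all these sums only composable components contribute. A connecting system for $\pi_2$ is a set $\Sigma_{\pi_2}\subset\pi$ such that for each path $\gamma$ in $\pi_2$ there is a unique $\beta_\gamma\in\Sigma_{\pi_2}$ with $t_\pi(\beta_\gamma)=s(\gamma)$, with $\beta_{\gamma\circ\gamma'}=\beta_{\gamma'}$, and each $\beta\in\Sigma_{\pi_2}$ equals $\beta_\gamma$ for at least one $\gamma$. It is quasi-unique if for each path $\gamma$ in $\pi_2$ there exist a path $\gamma'$ in $\pi_2$ with $t(\gamma')=s(\gamma)$ and an element $\beta_1\in\Sigma_{\pi_2}$ with $t_\pi(\beta_1)=s(\gamma')$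 and $s_\pi^{-1}(s_\pi(\beta_1))=\{\beta_1\}$. For a family of operators $l(\beta,\beta)$, $\beta\in\Sigma_{\pi_2}$, where $l(\beta,\beta)$ acts on the part of $(V^{\pi_2})^{\otimes m}$ of source $t_\pi(\beta)$, $l_\lhd$ denotes the operator in $\operatorname{End}((V^{\pi_2})^{\otimes m})$ given on that part by $l(\beta,\beta)$. Given $j$ with right inverse $j^{-1}$, put, for $\beta_1,\beta_2\in\pi$, $\check R_2(\beta_2,\beta_1):=\sum_\beta j^{-1}(\beta,\beta_2)\check R_1j(\beta_1,\beta)$, written $j^{-1}*_\circ(\check R_1j)$ (the spectral parameter $z$ is suppressed); its components with $\beta_1=\beta_2\in\Sigma_{\pi_2}$ give $(\check R_2)_\lhd\in\operatorname{End}(V^{\pi_2}\otimes V^{\pi_2})$. The map $j$ is called a twist for the quasi-unique connecting system if for any length 3 path $\gamma$ in $\pi_2$ (with $\gamma'$ as in quasi-uniqueness, of length $n-3$) the following hold. (i) Weight zero (ice rule) condition: there exists a right invertible $q_2\in\Gamma(\pi\times\pi,\overline{\operatorname{Hom}}((V^{\pi_2})^{\otimes3},(V^{\pi_1})^{\otimes3}))$ such that for any $\beta_2$ with $t_\pi(\beta_2)=s(\gamma)$ and any $\beta_2'$ with $s_\pi(\beta_2')=s_\pi(\beta_2)$, $$\mathrm{id}_{V^{\pi_2}}\otimes(\check R_2)_\lhd\,\delta_{\beta_2,\beta_2'}=\big(q_2^{-1}*_\circ((\mathrm{id}_{V^{\pi_1}}\otimes\check R_1)q_2)\big)(\beta_2,\beta_2'),$$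 $$(\check R_2)_\lhd\otimes\mathrm{id}_{V^{\pi_2}}\,\delta_{\beta_2,\beta_2'}=\big(q_2^{-1}*_\circ((\check R_1\otimes\mathrm{id}_{V^{\pi_1}})q_2)\big)(\beta_2,\beta_2').$$ (ii) There exists a right invertible $q\in\Gamma(\pi\times\pi,\overline{\operatorname{Hom}}((V^{\pi_2})^{\otimes n},(V^{\pi_1})^{\otimes n}))$ such that on $(V^{\pi_2})^{\otimes n}_{\gamma\gamma'}$ (the component along $\gamma'$ followed by $\gamma$, namely $(V^{\pi_2})^{\otimes n-3}_{\gamma'}\otimes(V^{\pi_2})^{\otimes3}_{\gamma}$) $$\mathrm{id}^{\otimes n-2}_{V^{\pi_2}}\otimes(\check R_2)_\lhd=\big(q^{-1}*_\circ((\mathrm{id}^{\otimes n-2}_{V^{\pi_1}}\otimes\check R_1)q)\big)_\lhd,$$ $$\mathrm{id}^{\otimes n-3}_{V^{\pi_2}}\otimes(\check R_2)_\lhd\otimes\mathrm{id}_{V^{\pi_2}}=\big(q^{-1}*_\circ((\mathrm{id}^{\otimes n-3}_{V^{\pi_1}}\otimes\check R_1\otimes\mathrm{id}_{V^{\pi_1}})q)\big)_\lhd.$$ (iii) Factorization: there exists an invertible $q_1\in\Gamma(\pi\times\pi,\overline{\operatorname{Hom}}((V^{\pi_2})^{\otimes n-3},(V^{\pi_1})^{\otimes n-3}))$ such that $q|_{(V^{\pi_2})^{\otimes n}_{\gamma\gamma'}}=q_1|_{(V^{\pi_2})^{\otimes n-3}_{\gamma'}}*_\otimes q_2|_{(V^{\pi_2})^{\otimes3}_{\gamma}}$.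 *)

theory Defs
  imports "HOL-Complex_Analysis.Complex_Analysis" "HOL-Library.Groups_Big_Fun"
begin

section \<open>Groupoids and graded vector spaces of finite type\<close>

text \<open>\<open>cmp G \<beta> \<alpha>\<close> is \<open>\<beta> \<circ> \<alpha>\<close>: first \<open>\<alpha>\<close>, then \<open>\<beta>\<close>.\<close>

record ('o, 'a) groupoid =
  Obj :: "'o set"
  Arr :: "'a set"
  src :: "'a \<Rightarrow> 'o"
  tgt :: "'a \<Rightarrow> 'o"
  cmp :: "'a \<Rightarrow> 'a \<Rightarrow> 'a"
  idt :: "'o \<Rightarrow> 'a"

definition groupoid :: "('o, 'a, 'm) groupoid_scheme \<Rightarrow> bool" where
  "groupoid G \<longleftrightarrow>
     (\<forall>\<alpha>\<in>Arr G. src G \<alpha> \<in> Obj G \<and> tgt G \<alpha> \<in> Obj G) \<and>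
     (\<forall>a\<in>Obj G. idt G a \<in> Arr G \<and> src G (idt G a) = a \<and> tgt G (idt G a) = a) \<and>
     (\<forall>\<alpha>\<in>Arr G. \<forall>\<beta>\<in>Arr G. tgt G \<alpha> = src G \<beta> \<longrightarrow>
        cmp G \<beta> \<alpha> \<in> Arr G \<and> src G (cmp G \<beta> \<alpha>) = src G \<alpha> \<and> tgt G (cmp G \<beta> \<alpha>) = tgt G \<beta>) \<and>
     (\<forall>\<alpha>\<in>Arr G. \<forall>\<beta>\<in>Arr G. \<forall>\<gamma>\<in>Arr G. tgt G \<alpha> = src G \<beta> \<longrightarrow> tgt G \<beta> = src G \<gamma> \<longrightarrow>
        cmp G \<gamma> (cmp G \<beta> \<alpha>) = cmp G (cmp G \<gamma> \<beta>) \<alpha>) \<and>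
     (\<forall>\<alpha>\<in>Arr G. cmp G \<alpha> (idt G (src G \<alpha>)) = \<alpha> \<and> cmp G (idt G (tgt G \<alpha>)) \<alpha> = \<alpha>) \<and>
     (\<forall>\<alpha>\<in>Arr G. \<exists>\<beta>\<in>Arr G. src G \<beta> = tgt G \<alpha> \<and> tgt G \<beta> = src G \<alpha> \<and>
        cmp G \<beta> \<alpha> = idt G (src G \<alpha>) \<and> cmp G \<alpha> \<beta> = idt G (tgt G \<alpha>))"

text \<open>A graded space is given in coordinates: \<open>V\<^sub>\<alpha> = \<complex>\<^sup>d\<close> with \<open>d = vdim V \<alpha>\<close>; the pair
  \<open>(\<alpha>, i)\<close>, \<open>i < vdim V \<alpha>\<close>, stands for the \<open>i\<close>-th basis vector of \<open>V\<^sub>\<alpha>\<close>.\<close>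

record ('o, 'a) graded = "('o, 'a) groupoid" +
  vdim :: "'a \<Rightarrow> nat"

definition finite_type :: "('o, 'a) graded \<Rightarrow> bool" where
  "finite_type V \<longleftrightarrow>
     (\<forall>a\<in>Obj V. finite {\<alpha> \<in> Arr V. (src V \<alpha> = a \<or> tgt V \<alpha> = a) \<and> vdim V \<alpha> \<noteq> 0})"

text \<open>Paths are the nonempty composable sequences of arrows \<open>\<alpha>\<close> with \<open>V\<^sub>\<alpha> \<noteq> 0\<close>, listed in the
  order in which they are traversed; their length is the number of arrows.\<close>

definition is_path :: "('o, 'a) graded \<Rightarrow> 'a list \<Rightarrow> bool" where
  "is_path V p \<longleftrightarrow> p \<noteq> [] \<and> set p \<subseteq> {\<alpha> \<in> Arr V. vdim V \<alpha> \<noteq> 0} \<and>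
     successively (\<lambda>\<alpha> \<beta>. tgt V \<alpha> = src V \<beta>) p"

definition psrc :: "('o, 'a) graded \<Rightarrow> 'a list \<Rightarrow> 'o" where
  "psrc V p = src V (hd p)"

definition ptgt :: "('o, 'a) graded \<Rightarrow> 'a list \<Rightarrow> 'o" where
  "ptgt V p = tgt V (last p)"

fun path_arrow :: "('o, 'a) graded \<Rightarrow> 'a list \<Rightarrow> 'a" where
  "path_arrow V [] = undefined"
| "path_arrow V [\<alpha>] = \<alpha>"
| "path_arrow V (\<alpha> # \<beta> # p) = cmp V (path_arrow V (\<beta> # p)) \<alpha>"

text \<open>A word \<open>[(\<alpha>\<^sub>1, i\<^sub>1), \<dots>, (\<alpha>\<^sub>m, i\<^sub>m)]\<close> with composable \<open>\<alpha>\<^sub>1, \<dots>, \<alpha>\<^sub>m\<close> is the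
  corresponding basis vector of the \<open>m\<close>-th tensor power of \<open>V\<close>; its degree is
  \<open>\<alpha>\<^sub>m \<circ> \<dots> \<circ> \<alpha>\<^sub>1\<close>. Only \<open>m > 0\<close> is used.\<close>

type_synonym 'a word = "('a \<times> nat) list"

definition words :: "('o, 'a) graded \<Rightarrow> nat \<Rightarrow> 'a word set" where
  "words V m = {x. length x = m \<and> (\<forall>(\<alpha>, i)\<in>set x. \<alpha> \<in> Arr V \<and> i < vdim V \<alpha>) \<and>
     successively (\<lambda>\<alpha> \<beta>. tgt V \<alpha> = src V \<beta>) (map fst x)}"

definition wdeg :: "('o, 'a) graded \<Rightarrow> 'a word \<Rightarrow> 'a" where
  "wdeg V x = path_arrow V (map fst x)"

definition wsrc :: "('o, 'a) graded \<Rightarrow> 'a word \<Rightarrow> 'o" where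
  "wsrc V x = psrc V (map fst x)"

definition wtgt :: "('o, 'a) graded \<Rightarrow> 'a word \<Rightarrow> 'o" where
  "wtgt V x = ptgt V (map fst x)"

section \<open>Linear maps between tensor powers\<close>

text \<open>A linear map is represented by its matrix: \<open>A x y\<close> is the coefficient of \<open>x\<close> in the
  image of \<open>y\<close>. \<open>Sum_any\<close> is the sum over the (finite) support of its argument.\<close>

type_synonym ('a, 'b) mat = "'a word \<Rightarrow> 'b word \<Rightarrow> complex"

definition mmul :: "('a, 'b) mat \<Rightarrow> ('b, 'c) mat \<Rightarrow> ('a, 'c) mat" (infixl "\<odot>" 70) where
  "(A \<odot> B) x z = Sum_any (\<lambda>y. A x y * B y z)"

definition endo :: "('o, 'a) graded \<Rightarrow> nat \<Rightarrow> ('a, 'a) mat \<Rightarrow> bool" where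
  "endo V m A \<longleftrightarrow> (\<forall>x y. A x y \<noteq> 0 \<longrightarrow> x \<in> words V m \<and> y \<in> words V m \<and> wdeg V x = wdeg V y)"

definition idm :: "('o, 'a) graded \<Rightarrow> nat \<Rightarrow> ('a, 'a) mat" where
  "idm V m x y = of_bool (x = y \<and> y \<in> words V m)"

text \<open>The tensor product of \<open>A\<close>, acting on \<open>p\<close>-th tensor powers, with \<open>B\<close>; the condition
  \<open>joins\<close> keeps the composable components only.\<close>

definition joins :: "('o, 'a) graded \<Rightarrow> nat \<Rightarrow> 'a word \<Rightarrow> bool" where
  "joins V p x \<longleftrightarrow> wtgt V (take p x) = wsrc V (drop p x)"

definition tens ::
  "('o, 'a) graded \<Rightarrow> ('o2, 'b) graded \<Rightarrow> nat \<Rightarrow> ('a, 'b) mat \<Rightarrow> ('a, 'b) mat \<Rightarrow> ('a, 'b) mat" where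
  "tens V W p A B x y =
     (if joins V p x \<and> joins W p y then A (take p x) (take p y) * B (drop p x) (drop p y) else 0)"

section \<open>Yang--Baxter operators\<close>

definition regular_points :: "(complex \<Rightarrow> ('a, 'a) mat) \<Rightarrow> complex set" where
  "regular_points R = {z. \<forall>x y. (\<lambda>z. R z x y) analytic_on {z}}"

definition op12 :: "('o, 'a) graded \<Rightarrow> ('a, 'a) mat \<Rightarrow> ('a, 'a) mat" where
  "op12 V A = tens V V 2 A (idm V 1)"

definition op23 :: "('o, 'a) graded \<Rightarrow> ('a, 'a) mat \<Rightarrow> ('a, 'a) mat" where
  "op23 V A = tens V V 1 (idm V 1) A"

text \<open>The pole set is required to be discrete for all matrix entries jointly. The two relations
  are identities of meromorphic functions, hence imposed at regular arguments only.\<close>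

definition yang_baxter :: "('o, 'a) graded \<Rightarrow> (complex \<Rightarrow> ('a, 'a) mat) \<Rightarrow> bool" where
  "yang_baxter V R \<longleftrightarrow>
     (\<forall>z. endo V 2 (R z)) \<and>
     (\<forall>x y. (\<lambda>z. R z x y) meromorphic_on UNIV) \<and>
     (- regular_points R) sparse_in UNIV \<and>
     (\<forall>z w. z \<in> regular_points R \<longrightarrow> w \<in> regular_points R \<longrightarrow> z - w \<in> regular_points R \<longrightarrow>
        op23 V (R (z - w)) \<odot> op12 V (R z) \<odot> op23 V (R w) =
        op12 V (R w) \<odot> op23 V (R z) \<odot> op12 V (R (z - w))) \<and>
     (\<forall>z. z \<in> regular_points R \<longrightarrow> - z \<in> regular_points R \<longrightarrow> R z \<odot> R (- z) = idm V 2)"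

section \<open>Transfer operators\<close>

text \<open>\<open>edges D\<close> is the set \<open>\<pi>\<close> of arrows from the groupoid of \<open>sp1 D\<close> to the one of
  \<open>sp2 D\<close>.\<close>

record ('o, 'a, 'q, 'b, 'p) transfer_data =
  sp1 :: "('o, 'a) graded"
  sp2 :: "('q, 'b) graded"
  edges :: "'p set"
  esrc :: "'p \<Rightarrow> 'o"
  etgt :: "'p \<Rightarrow> 'q"

definition valid_transfer_data :: "('o, 'a, 'q, 'b, 'p) transfer_data \<Rightarrow> bool" where
  "valid_transfer_data D \<longleftrightarrow>
     groupoid (sp1 D) \<and> finite_type (sp1 D) \<and> groupoid (sp2 D) \<and> finite_type (sp2 D) \<and>
     esrc D ` edges D = Obj (sp1 D) \<and> etgt D ` edges D = Obj (sp2 D)"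

definition no_multi_edge :: "('o, 'a, 'q, 'b, 'p) transfer_data \<Rightarrow> bool" where
  "no_multi_edge D \<longleftrightarrow>
     (\<forall>\<beta>\<in>edges D. \<forall>\<beta>'\<in>edges D. esrc D \<beta> = esrc D \<beta>' \<longrightarrow> etgt D \<beta> = etgt D \<beta>' \<longrightarrow> \<beta> = \<beta>')"

text \<open>\<open>\<Gamma>(\<pi> \<times> \<pi>, Hom(W, V))\<close> and \<open>\<Gamma>(\<pi> \<times> \<pi>, Hom(V, W))\<close> for the \<open>m\<close>-th tensor
  powers \<open>V\<close> of \<open>sp1 D\<close> and \<open>W\<close> of \<open>sp2 D\<close>. That only finitely many components occur
  for given \<open>\<beta>\<^sub>1, \<beta>\<^sub>2\<close> is automatic from the finite type condition.\<close>

definition Gamma_WV ::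
  "('o, 'a, 'q, 'b, 'p) transfer_data \<Rightarrow> nat \<Rightarrow> ('p \<Rightarrow> 'p \<Rightarrow> ('a, 'b) mat) set" where
  "Gamma_WV D m = {g. \<forall>\<beta>1\<in>edges D. \<forall>\<beta>2\<in>edges D. \<forall>x y. g \<beta>1 \<beta>2 x y \<noteq> 0 \<longrightarrow>
     x \<in> words (sp1 D) m \<and> y \<in> words (sp2 D) m \<and>
     wsrc (sp1 D) x = esrc D \<beta>1 \<and> wtgt (sp1 D) x = esrc D \<beta>2 \<and>
     wsrc (sp2 D) y = etgt D \<beta>1 \<and> wtgt (sp2 D) y = etgt D \<beta>2}"

definition Gamma_VW ::
  "('o, 'a, 'q, 'b, 'p) transfer_data \<Rightarrow> nat \<Rightarrow> ('p \<Rightarrow> 'p \<Rightarrow> ('b, 'a) mat) set" where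
  "Gamma_VW D m = {f. \<forall>\<beta>1\<in>edges D. \<forall>\<beta>2\<in>edges D. \<forall>x y. f \<beta>1 \<beta>2 x y \<noteq> 0 \<longrightarrow>
     x \<in> words (sp2 D) m \<and> y \<in> words (sp1 D) m \<and>
     wsrc (sp1 D) y = esrc D \<beta>2 \<and> wtgt (sp1 D) y = esrc D \<beta>1 \<and>
     wsrc (sp2 D) x = etgt D \<beta>2 \<and> wtgt (sp2 D) x = etgt D \<beta>1}"

text \<open>The sum over \<open>\<beta> \<in> \<pi>\<close>; only finitely many terms contribute to each matrix entry
  of the sums below when there is no multi-edge.\<close>

definition edge_sum ::
  "('o, 'a, 'q, 'b, 'p) transfer_data \<Rightarrow> ('p \<Rightarrow> ('c, 'e) mat) \<Rightarrow> ('c, 'e) mat" where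
  "edge_sum D M x y = Sum_any (\<lambda>\<beta>. if \<beta> \<in> edges D then M \<beta> x y else 0)"

definition fusion ::
  "('o, 'a, 'q, 'b, 'p) transfer_data \<Rightarrow> nat \<Rightarrow> ('p \<Rightarrow> 'p \<Rightarrow> ('a, 'b) mat) \<Rightarrow>
   ('p \<Rightarrow> 'p \<Rightarrow> ('a, 'b) mat) \<Rightarrow> 'p \<Rightarrow> 'p \<Rightarrow> ('a, 'b) mat" where
  "fusion D p g g' \<beta>1 \<beta>2 = edge_sum D (\<lambda>\<beta>. tens (sp1 D) (sp2 D) p (g \<beta>1 \<beta>) (g' \<beta> \<beta>2))"

definition circ ::
  "('o, 'a, 'q, 'b, 'p) transfer_data \<Rightarrow> ('p \<Rightarrow> 'p \<Rightarrow> ('b, 'a) mat) \<Rightarrow>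
   ('p \<Rightarrow> 'p \<Rightarrow> ('a, 'b) mat) \<Rightarrow> 'p \<Rightarrow> 'p \<Rightarrow> ('b, 'b) mat" where
  "circ D f h \<beta>1 \<beta>2 = edge_sum D (\<lambda>\<beta>. f \<beta> \<beta>2 \<odot> h \<beta>1 \<beta>)"

definition op_act ::
  "('a, 'a) mat \<Rightarrow> ('p \<Rightarrow> 'p \<Rightarrow> ('a, 'b) mat) \<Rightarrow> 'p \<Rightarrow> 'p \<Rightarrow> ('a, 'b) mat" where
  "op_act Q g \<beta>1 \<beta>2 = Q \<odot> g \<beta>1 \<beta>2"

text \<open>\<open>f(\<beta>\<^sub>1, \<cdot>)\<close> acts on the \<open>V\<^sub>\<alpha>\<close> with target \<open>s(\<beta>\<^sub>1)\<close> and \<open>g(\<beta>\<^sub>1, \<cdot>)\<close> acts on the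
  \<open>W\<^sub>\<gamma>\<close> with source \<open>t(\<beta>\<^sub>1)\<close> (all of them, as \<open>esrc D\<close> and \<open>etgt D\<close> are surjective).
  These are the domains of the identities in the definitions of right and left inverse.\<close>

definition id_VW :: "('o, 'a, 'q, 'b, 'p) transfer_data \<Rightarrow> nat \<Rightarrow> 'p \<Rightarrow> ('a, 'a) mat" where
  "id_VW D m \<beta> x y = of_bool (x = y \<and> y \<in> words (sp1 D) m \<and> wtgt (sp1 D) y = esrc D \<beta>)"

definition id_WV :: "('o, 'a, 'q, 'b, 'p) transfer_data \<Rightarrow> nat \<Rightarrow> 'p \<Rightarrow> ('b, 'b) mat" where
  "id_WV D m \<beta> x y = of_bool (x = y \<and> y \<in> words (sp2 D) m \<and> wsrc (sp2 D) y = etgt D \<beta>)"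

definition right_inverse ::
  "('o, 'a, 'q, 'b, 'p) transfer_data \<Rightarrow> nat \<Rightarrow>
   ('p \<Rightarrow> 'p \<Rightarrow> ('a, 'b) mat) \<Rightarrow> ('p \<Rightarrow> 'p \<Rightarrow> ('b, 'a) mat) \<Rightarrow> bool" where
  "right_inverse D m g f \<longleftrightarrow> g \<in> Gamma_WV D m \<and> f \<in> Gamma_VW D m \<and>
     (\<forall>\<beta>1\<in>edges D. \<forall>\<beta>2\<in>edges D. etgt D \<beta>1 = etgt D \<beta>2 \<longrightarrow>
        edge_sum D (\<lambda>\<beta>. g \<beta> \<beta>2 \<odot> f \<beta>1 \<beta>) = (if \<beta>1 = \<beta>2 then id_VW D m \<beta>1 else (\<lambda>_ _. 0)))"

definition left_inverse ::
  "('o, 'a, 'q, 'b, 'p) transfer_data \<Rightarrow> nat \<Rightarrow>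
   ('p \<Rightarrow> 'p \<Rightarrow> ('a, 'b) mat) \<Rightarrow> ('p \<Rightarrow> 'p \<Rightarrow> ('b, 'a) mat) \<Rightarrow> bool" where
  "left_inverse D m g f \<longleftrightarrow> g \<in> Gamma_WV D m \<and> f \<in> Gamma_VW D m \<and>
     (\<forall>\<beta>1\<in>edges D. \<forall>\<beta>2\<in>edges D. esrc D \<beta>1 = esrc D \<beta>2 \<longrightarrow>
        circ D f g \<beta>1 \<beta>2 = (if \<beta>1 = \<beta>2 then id_WV D m \<beta>1 else (\<lambda>_ _. 0)))"

section \<open>Connecting systems\<close>

definition connecting_edge ::
  "('o, 'a, 'q, 'b, 'p) transfer_data \<Rightarrow> 'p set \<Rightarrow> 'q \<Rightarrow> 'p" where
  "connecting_edge D S b = (THE \<beta>. \<beta> \<in> S \<and> etgt D \<beta> = b)"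

definition connecting_system :: "('o, 'a, 'q, 'b, 'p) transfer_data \<Rightarrow> 'p set \<Rightarrow> bool" where
  "connecting_system D S \<longleftrightarrow> S \<subseteq> edges D \<and>
     (\<forall>\<gamma>. is_path (sp2 D) \<gamma> \<longrightarrow> (\<exists>!\<beta>. \<beta> \<in> S \<and> etgt D \<beta> = psrc (sp2 D) \<gamma>)) \<and>
     (\<forall>\<gamma> \<gamma>'. is_path (sp2 D) \<gamma> \<longrightarrow> is_path (sp2 D) \<gamma>' \<longrightarrow>
        ptgt (sp2 D) \<gamma>' = psrc (sp2 D) \<gamma> \<longrightarrow>
        connecting_edge D S (psrc (sp2 D) (\<gamma>' @ \<gamma>)) = connecting_edge D S (psrc (sp2 D) \<gamma>')) \<and>
     (\<forall>\<beta>\<in>S. \<exists>\<gamma>. is_path (sp2 D) \<gamma> \<and> \<beta> = connecting_edge D S (psrc (sp2 D) \<gamma>))"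

definition quasi_unique_at ::
  "('o, 'a, 'q, 'b, 'p) transfer_data \<Rightarrow> 'p set \<Rightarrow> 'b list \<Rightarrow> 'b list \<Rightarrow> bool" where
  "quasi_unique_at D S \<gamma> \<gamma>' \<longleftrightarrow> is_path (sp2 D) \<gamma>' \<and> ptgt (sp2 D) \<gamma>' = psrc (sp2 D) \<gamma> \<and>
     (\<exists>\<beta>1\<in>S. etgt D \<beta>1 = psrc (sp2 D) \<gamma>' \<and> {\<beta>\<in>edges D. esrc D \<beta> = esrc D \<beta>1} = {\<beta>1})"

definition quasi_unique :: "('o, 'a, 'q, 'b, 'p) transfer_data \<Rightarrow> 'p set \<Rightarrow> bool" where
  "quasi_unique D S \<longleftrightarrow> (\<forall>\<gamma>. is_path (sp2 D) \<gamma> \<longrightarrow> (\<exists>\<gamma>'. quasi_unique_at D S \<gamma> \<gamma>'))"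

text \<open>\<open>l(\<beta>, \<beta>)\<close> may have components between distinct parallel arrows when the second groupoid
  has nontrivial isotropy. The operator it determines in \<open>End\<close> consists of its
  degree-preserving components.\<close>

definition lhd ::
  "('o, 'a, 'q, 'b, 'p) transfer_data \<Rightarrow> 'p set \<Rightarrow> nat \<Rightarrow> ('p \<Rightarrow> 'p \<Rightarrow> ('b, 'b) mat) \<Rightarrow>
   ('b, 'b) mat" where
  "lhd D S m l x y =
     (if x \<in> words (sp2 D) m \<and> y \<in> words (sp2 D) m \<and> wdeg (sp2 D) x = wdeg (sp2 D) y
      then let \<beta> = connecting_edge D S (wsrc (sp2 D) y) in l \<beta> \<beta> x y else 0)"

section \<open>Twists\<close>

definition twisted ::
  "('o, 'a, 'q, 'b, 'p) transfer_data \<Rightarrow> ('p \<Rightarrow> 'p \<Rightarrow> ('a, 'b) mat) \<Rightarrow>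
   ('p \<Rightarrow> 'p \<Rightarrow> ('b, 'a) mat) \<Rightarrow> (complex \<Rightarrow> ('a, 'a) mat) \<Rightarrow> complex \<Rightarrow>
   'p \<Rightarrow> 'p \<Rightarrow> ('b, 'b) mat" where
  "twisted D j ji R1 z \<beta>2 \<beta>1 = circ D ji (op_act (R1 z) j) \<beta>1 \<beta>2"

definition twisted_lhd ::
  "('o, 'a, 'q, 'b, 'p) transfer_data \<Rightarrow> 'p set \<Rightarrow> ('p \<Rightarrow> 'p \<Rightarrow> ('a, 'b) mat) \<Rightarrow>
   ('p \<Rightarrow> 'p \<Rightarrow> ('b, 'a) mat) \<Rightarrow> (complex \<Rightarrow> ('a, 'a) mat) \<Rightarrow> complex \<Rightarrow> ('b, 'b) mat" where
  "twisted_lhd D S j ji R1 z = lhd D S 2 (twisted D j ji R1 z)"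

definition weight_zero ::
  "('o, 'a, 'q, 'b, 'p) transfer_data \<Rightarrow> 'b list \<Rightarrow>
   (complex \<Rightarrow> ('a, 'a) mat) \<Rightarrow> (complex \<Rightarrow> ('b, 'b) mat) \<Rightarrow>
   ('p \<Rightarrow> 'p \<Rightarrow> ('a, 'b) mat) \<Rightarrow> ('p \<Rightarrow> 'p \<Rightarrow> ('b, 'a) mat) \<Rightarrow> bool" where
  "weight_zero D \<gamma> R1 R2 q2 q2i \<longleftrightarrow>
     (\<forall>z\<in>regular_points R1. \<forall>\<beta>2\<in>edges D. \<forall>\<beta>2'\<in>edges D.
        etgt D \<beta>2 = psrc (sp2 D) \<gamma> \<longrightarrow> esrc D \<beta>2' = esrc D \<beta>2 \<longrightarrow>
        (\<forall>x. \<forall>y\<in>words (sp2 D) 3. wsrc (sp2 D) y = etgt D \<beta>2 \<longrightarrow>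
           op23 (sp2 D) (R2 z) x y * of_bool (\<beta>2 = \<beta>2') =
             circ D q2i (op_act (op23 (sp1 D) (R1 z)) q2) \<beta>2 \<beta>2' x y \<and>
           op12 (sp2 D) (R2 z) x y * of_bool (\<beta>2 = \<beta>2') =
             circ D q2i (op_act (op12 (sp1 D) (R1 z)) q2) \<beta>2 \<beta>2' x y))"

text \<open>The basis of the component along \<open>\<gamma>'\<close> followed by \<open>\<gamma>\<close>: the first \<open>length \<gamma>'\<close> factors
  have degree \<open>\<gamma>'\<close>, the last three have degree \<open>\<gamma>\<close>.\<close>

definition words_along :: "('o, 'a) graded \<Rightarrow> 'a list \<Rightarrow> 'a list \<Rightarrow> 'a word set" where
  "words_along W \<gamma>' \<gamma> = {y \<in> words W (length \<gamma>' + 3).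
     wdeg W (take (length \<gamma>') y) = path_arrow W \<gamma>' \<and>
     wdeg W (drop (length \<gamma>') y) = path_arrow W \<gamma>}"

text \<open>With \<open>n = k + 3\<close>, the identity tensor factors are \<open>n - 2\<close> and \<open>n - 3\<close> in number.\<close>

definition conjugates_along ::
  "('o, 'a, 'q, 'b, 'p) transfer_data \<Rightarrow> 'p set \<Rightarrow> 'b list \<Rightarrow> 'b list \<Rightarrow>
   (complex \<Rightarrow> ('a, 'a) mat) \<Rightarrow> (complex \<Rightarrow> ('b, 'b) mat) \<Rightarrow>
   ('p \<Rightarrow> 'p \<Rightarrow> ('a, 'b) mat) \<Rightarrow> ('p \<Rightarrow> 'p \<Rightarrow> ('b, 'a) mat) \<Rightarrow> bool" where
  "conjugates_along D S \<gamma>' \<gamma> R1 R2 q qi \<longleftrightarrow>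
     (let V = sp1 D; W = sp2 D; k = length \<gamma>' in
      \<forall>z\<in>regular_points R1. \<forall>x. \<forall>y\<in>words_along W \<gamma>' \<gamma>.
        tens W W (k + 1) (idm W (k + 1)) (R2 z) x y =
          lhd D S (k + 3) (circ D qi (op_act (tens V V (k + 1) (idm V (k + 1)) (R1 z)) q)) x y \<and>
        tens W W k (idm W k) (op12 W (R2 z)) x y =
          lhd D S (k + 3) (circ D qi (op_act (tens V V k (idm V k) (op12 V (R1 z))) q)) x y)"

definition factorizes_along ::
  "('o, 'a, 'q, 'b, 'p) transfer_data \<Rightarrow> 'b list \<Rightarrow> 'b list \<Rightarrow> ('p \<Rightarrow> 'p \<Rightarrow> ('a, 'b) mat) \<Rightarrow>
   ('p \<Rightarrow> 'p \<Rightarrow> ('a, 'b) mat) \<Rightarrow> ('p \<Rightarrow> 'p \<Rightarrow> ('a, 'b) mat) \<Rightarrow> bool" where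
  "factorizes_along D \<gamma>' \<gamma> q q1 q2 \<longleftrightarrow>
     (\<forall>\<beta>1\<in>edges D. \<forall>\<beta>2\<in>edges D. \<forall>x. \<forall>y\<in>words_along (sp2 D) \<gamma>' \<gamma>.
        q \<beta>1 \<beta>2 x y = fusion D (length \<gamma>') q1 q2 \<beta>1 \<beta>2 x y)"

definition is_twist ::
  "('o, 'a, 'q, 'b, 'p) transfer_data \<Rightarrow> 'p set \<Rightarrow> (complex \<Rightarrow> ('a, 'a) mat) \<Rightarrow>
   ('p \<Rightarrow> 'p \<Rightarrow> ('a, 'b) mat) \<Rightarrow> ('p \<Rightarrow> 'p \<Rightarrow> ('b, 'a) mat) \<Rightarrow> bool" where
  "is_twist D S R1 j ji \<longleftrightarrow>
     (\<forall>\<gamma>. is_path (sp2 D) \<gamma> \<and> length \<gamma> = 3 \<longrightarrow>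
        (\<exists>\<gamma>'. quasi_unique_at D S \<gamma> \<gamma>' \<and>
           (\<exists>q2 q2i. right_inverse D 3 q2 q2i \<and>
              weight_zero D \<gamma> R1 (twisted_lhd D S j ji R1) q2 q2i \<and>
              (\<exists>q qi. right_inverse D (length \<gamma>' + 3) q qi \<and>
                 conjugates_along D S \<gamma>' \<gamma> R1 (twisted_lhd D S j ji R1) q qi \<and>
                 (\<exists>q1 q1i. right_inverse D (length \<gamma>') q1 q1i \<and> left_inverse D (length \<gamma>') q1 q1i \<and>
                    factorizes_along D \<gamma>' \<gamma> q q1 q2)))))"

end

theory Submission
  imports "Jordan_Normal_Form.Determinant" Defs
begin

text \<open>
  The operator \<open>R\<^sub>2\<close> is obtained from \<open>R\<^sub>1\<close> by conjugating with a transfer operator, so the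
  point is that conjugation is compatible with products and units. Fix an object \<open>a\<close> of the first
  groupoid and an object \<open>c\<close> of the second. A transfer operator \<open>g\<close> on \<open>m\<close>-th tensor powers
  restricts to a matrix whose rows are the walks of length \<open>m\<close> from \<open>a\<close> in the first groupoid
  followed by an edge into \<open>c\<close> (\<open>upper\<close>), and whose columns are the edges out of \<open>a\<close> followed by a
  walk of length \<open>m\<close> in the second groupoid ending at \<open>c\<close> (\<open>lower\<close>). By the finite type condition
  and the absence of multi-edges, both index sets are finite, so right and left inverses are
  one-sided inverses of finite matrices \<open>G\<close>, \<open>F\<close>.

  Since \<open>G F = 1\<close>, the map \<open>Q \<mapsto> F Q G\<close> is multiplicative (\<open>sandwich_mmul\<close>). The weight zero
  condition says that for \<open>Q\<close> one of the two embeddings of \<open>R\<^sub>1\<close> into the third tensor power, \<open>F Q G\<close>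
  has no components from an edge into the source of \<open>\<gamma>\<close> to a different edge, and acts at such an
  edge by the corresponding embedding of \<open>R\<^sub>2\<close> (\<open>implements\<close>). Products of such operators are again of this kind, which carries the Yang--Baxter
  equation over from \<open>R\<^sub>1\<close> to \<open>R\<^sub>2\<close> (\<open>braid_relation_if_weight_zero\<close>).

  For the inversion relation one also needs \<open>F 1 G = 1\<close>, that is, \<open>F G = 1\<close> on the third tensor
  power. As \<open>G F = 1\<close>, this holds as soon as \<open>F\<close> and \<open>G\<close> are square, and this is a matter of counting.
  The right inverse of \<open>q\<^sub>2\<close> shows that there are at most as many upper as lower paths for walks of
  length 3, and the left inverse of \<open>q\<^sub>1\<close> gives the opposite inequality for walks of length \<open>k\<close>, the
  length of \<open>\<gamma>'\<close>. Consider now the zigzags from a fixed object: walk in the first groupoid, cross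
  along an edge, walk in the second, with total length \<open>3 k\<close>. Moving the crossing by 3 or by \<open>k\<close>
  at a time gives inequalities in both directions between the numbers of zigzags that cross at
  the start and at the end, so equality holds throughout, and there is equality for walks of
  length 3 from every object that is the end of a walk of length \<open>3 (k - 1)\<close>
  (\<open>card_lower_eq_upper_after_long_walk\<close>). Quasi-uniqueness provides walks of any length into the
  source of a given path; transferred back to the first groupoid they yield an edge into that source
  which starts at such an object, and the relation can be read off at that edge
  (\<open>inversion_if_weight_zero\<close>).

  Both relations are thereby proved at arguments at which \<open>R\<^sub>1\<close> is regular. The entries of \<open>R\<^sub>2\<close> are
  linear combinations of entries of \<open>R\<^sub>1\<close>, hence meromorphic with no new poles, but poles of
  \<open>R\<^sub>1\<close> may cancel; the relations at all regular arguments of \<open>R\<^sub>2\<close> follow by continuity.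
\<close>

section \<open>Sums of finite support and rectangular matrices\<close>

lemma Sum_any_reindex:
  assumes inj: "inj l" and supp: "\<And>a. g a \<noteq> 0 \<Longrightarrow> a \<in> range l"
  shows "Sum_any g = Sum_any (\<lambda>b. g (l b))"
proof -
  have "bij_betw l {b. g (l b) \<noteq> 0} {a. g a \<noteq> 0}"
    using supp by (auto simp: bij_betw_def intro: inj_on_subset[OF inj])
  from sum.reindex_bij_betw[OF this, of g] show ?thesis
    by (simp add: Sum_any.expand_set)
qed

text \<open>A sum over words, rewritten as a sum over pairs of a word and an edge whose edge is held
  fixed: this turns matrix products into sums over the index set of a block.\<close>

lemma Sum_any_fibre:
  assumes "finite X" and supp: "\<And>v. h v \<noteq> 0 \<Longrightarrow> (v, \<beta>) \<in> X"
  shows "Sum_any h = (\<Sum>p\<in>X. of_bool (snd p = \<beta>) * (h (fst p) :: complex))"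
proof -
  let ?V = "{v. (v, \<beta>) \<in> X}"
  have fin: "finite ?V"
    using finite_vimageI[OF \<open>finite X\<close>, of "\<lambda>v. (v, \<beta>)"] by (simp add: inj_on_def vimage_def)
  have "Sum_any h = sum h ?V"
    by (rule Sum_any.expand_superset) (use fin supp in auto)
  also have "\<dots> = (\<Sum>p\<in>(\<lambda>v. (v, \<beta>)) ` ?V. of_bool (snd p = \<beta>) * h (fst p))"
    by (subst sum.reindex) (auto simp: inj_on_def)
  also have "\<dots> = (\<Sum>p\<in>X. of_bool (snd p = \<beta>) * h (fst p))"
    by (rule sum.mono_neutral_left) (use \<open>finite X\<close> in auto)
  finally show ?thesis .
qed

lemma Sum_any_pairs:
  assumes "finite X" and supp: "\<And>\<beta> v. h \<beta> v \<noteq> 0 \<Longrightarrow> (v, \<beta>) \<in> X"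
  shows "Sum_any (\<lambda>\<beta>. Sum_any (h \<beta>)) = (\<Sum>p\<in>X. h (snd p) (fst p) :: complex)"
proof -
  have inner: "Sum_any (h \<beta>) = (\<Sum>p\<in>X. of_bool (snd p = \<beta>) * h (snd p) (fst p))" for \<beta>
    by (subst Sum_any_fibre[OF \<open>finite X\<close>, of _ \<beta>]) (auto intro!: sum.cong dest: supp)
  have "Sum_any (\<lambda>\<beta>. Sum_any (h \<beta>)) = (\<Sum>\<beta>\<in>snd ` X. Sum_any (h \<beta>))"
  proof (rule Sum_any.expand_superset)
    show "{\<beta>. Sum_any (h \<beta>) \<noteq> 0} \<subseteq> snd ` X"
      by (force dest: supp elim: Sum_any.not_neutral_obtains_not_neutral)
  qed (use \<open>finite X\<close> in simp)
  also have "\<dots> = (\<Sum>p\<in>X. \<Sum>\<beta>\<in>snd ` X. of_bool (snd p = \<beta>) * h (snd p) (fst p))"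
    unfolding inner by (rule sum.swap)
  also have "\<dots> = (\<Sum>p\<in>X. h (snd p) (fst p))"
  proof (rule sum.cong[OF refl])
    fix p assume "p \<in> X"
    then have "(\<Sum>\<beta>\<in>snd ` X. of_bool (snd p = \<beta>) * h (snd p) (fst p)) =
        (\<Sum>\<beta>\<in>{snd p}. of_bool (snd p = \<beta>) * h (snd p) (fst p))"
      using \<open>finite X\<close> by (intro sum.mono_neutral_right) auto
    then show "(\<Sum>\<beta>\<in>snd ` X. of_bool (snd p = \<beta>) * h (snd p) (fst p)) = h (snd p) (fst p)"
      by simp
  qed
  finally show ?thesis .
qed

text \<open>A right inverse of a matrix with no more columns than rows: pad both factors by zeros to
  square matrices. A one-sided inverse of a square matrix is two-sided, so the padding must have
  been empty.\<close>

lemma right_inverse_of_tall_matrix: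
  fixes G :: "'x \<Rightarrow> 'y \<Rightarrow> complex" and F :: "'y \<Rightarrow> 'x \<Rightarrow> complex"
  assumes fin: "finite X" "finite Y" and le: "card Y \<le> card X"
    and GF: "\<And>x x'. x \<in> X \<Longrightarrow> x' \<in> X \<Longrightarrow> (\<Sum>y\<in>Y. G x y * F y x') = of_bool (x = x')"
  shows "card Y = card X"
    and "\<And>y y'. y \<in> Y \<Longrightarrow> y' \<in> Y \<Longrightarrow> (\<Sum>x\<in>X. F y x * G x y') = of_bool (y = y')"
proof -
  define n m where "n = card X" and "m = card Y"
  have mn: "m \<le> n" using le by (simp add: n_def m_def)
  obtain ex where ex: "bij_betw ex {0..<n} X"
    using ex_bij_betw_nat_finite[OF fin(1)] by (auto simp: n_def)
  obtain ey where ey: "bij_betw ey {0..<m} Y"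
    using ex_bij_betw_nat_finite[OF fin(2)] by (auto simp: m_def)
  define A where "A = Matrix.mat n n (\<lambda>(i, l). if l < m then G (ex i) (ey l) else 0)"
  define B where "B = Matrix.mat n n (\<lambda>(l, i). if l < m then F (ey l) (ex i) else 0)"
  have carr: "A \<in> carrier_mat n n" "B \<in> carrier_mat n n" by (auto simp: A_def B_def)
  have exX: "ex i \<in> X" if "i < n" for i using ex that by (auto simp: bij_betw_def)
  have eyY: "ey l \<in> Y" if "l < m" for l using ey that by (auto simp: bij_betw_def)
  have ex_eq: "ex i = ex i' \<longleftrightarrow> i = i'" if "i < n" "i' < n" for i i'
    using ex that by (auto simp: bij_betw_def inj_on_def)
  have ey_eq: "ey i = ey i' \<longleftrightarrow> i = i'" if "i < m" "i' < m" for i i'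
    using ey that by (auto simp: bij_betw_def inj_on_def)
  have "A * B = 1\<^sub>m n"
  proof (rule eq_matI)
    fix i i'
    assume "i < dim_row (1\<^sub>m n :: complex Matrix.mat)"
      "i' < dim_col (1\<^sub>m n :: complex Matrix.mat)"
    then have i: "i < n" "i' < n" by auto
    have "(A * B) $$ (i, i') =
        (\<Sum>l\<in>{0..<n}. if l < m then G (ex i) (ey l) * F (ey l) (ex i') else 0)"
      using i by (auto simp: A_def B_def scalar_prod_def intro!: sum.cong)
    also have "\<dots> = (\<Sum>l\<in>{0..<m}. G (ex i) (ey l) * F (ey l) (ex i'))"
      by (rule sum.mono_neutral_cong_right) (use mn in auto)
    also have "\<dots> = (\<Sum>y\<in>Y. G (ex i) y * F y (ex i'))"
      by (rule sum.reindex_bij_betw[OF ey])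
    also have "\<dots> = of_bool (i = i')" using GF exX i by (simp add: ex_eq)
    finally show "(A * B) $$ (i, i') = 1\<^sub>m n $$ (i, i')" using i by simp
  qed (use carr in auto)
  then have BA: "B * A = 1\<^sub>m n" using mat_mult_left_right_inverse[OF carr] by simp
  have nm: "n = m"
  proof (rule ccontr)
    assume "n \<noteq> m"
    then have "m < n" using mn by simp
    then have "(B * A) $$ (m, m) = 0" by (simp add: A_def B_def scalar_prod_def)
    with BA \<open>m < n\<close> show False by simp
  qed
  then show "card Y = card X" by (simp add: n_def m_def)
  fix y y' assume "y \<in> Y" "y' \<in> Y"
  then have "y \<in> ey ` {0..<n}" "y' \<in> ey ` {0..<n}"
    using bij_betw_imp_surj_on[OF ey] nm by auto
  then obtain l l' where l: "l < n" "y = ey l" "l' < n" "y' = ey l'" by auto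
  have "(\<Sum>x\<in>X. F y x * G x y') = (\<Sum>i\<in>{0..<n}. F y (ex i) * G (ex i) y')"
    by (rule sum.reindex_bij_betw[OF ex, symmetric])
  also have "\<dots> = (B * A) $$ (l, l')"
    using l nm by (auto simp: A_def B_def scalar_prod_def intro!: sum.cong)
  finally show "(\<Sum>x\<in>X. F y x * G x y') = of_bool (y = y')"
    using BA l nm by (simp add: ey_eq)
qed

corollary card_le_if_right_inverse:
  fixes G :: "'x \<Rightarrow> 'y \<Rightarrow> complex" and F :: "'y \<Rightarrow> 'x \<Rightarrow> complex"
  assumes "finite X" "finite Y"
    and "\<And>x x'. x \<in> X \<Longrightarrow> x' \<in> X \<Longrightarrow> (\<Sum>y\<in>Y. G x y * F y x') = of_bool (x = x')"
  shows "card X \<le> card Y"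
  using right_inverse_of_tall_matrix(1)[OF assms(1,2) _ assms(3)] by linarith

section \<open>Walks\<close>

text \<open>Words with prescribed endpoints. Unlike in \<open>words\<close>, the empty word is meaningful here: it
  is the trivial walk at any object.\<close>

fun walk :: "('o, 'a) graded \<Rightarrow> 'o \<Rightarrow> 'a word \<Rightarrow> 'o \<Rightarrow> bool" where
  "walk V a [] b \<longleftrightarrow> a = b"
| "walk V a (p # x) b \<longleftrightarrow>
     fst p \<in> Arr V \<and> snd p < vdim V (fst p) \<and> src V (fst p) = a \<and> walk V (tgt V (fst p)) x b"

lemma walk_append: "walk V a (x @ y) b \<longleftrightarrow> (\<exists>c. walk V a x c \<and> walk V c y b)"
  by (induction V a x b arbitrary: y rule: walk.induct) auto

lemma walk_functional: "walk V a x b \<Longrightarrow> walk V a x b' \<Longrightarrow> b = b'"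
  by (induction x arbitrary: a) auto

lemma walk_functional_left: "walk V a x b \<Longrightarrow> walk V a' x b \<Longrightarrow> a = a'"
  by (cases x) auto

lemma walk_iff_word:
  assumes "x \<noteq> []"
  shows "walk V a x b \<longleftrightarrow> x \<in> words V (length x) \<and> wsrc V x = a \<and> wtgt V x = b"
  using assms
proof (induction x arbitrary: a)
  case (Cons p x)
  show ?case
  proof (cases x)
    case Nil
    then show ?thesis
      by (cases p) (auto simp: words_def wsrc_def wtgt_def psrc_def ptgt_def)
  next
    case x: (Cons q y)
    have "walk V (tgt V (fst p)) x b \<longleftrightarrow>
      x \<in> words V (length x) \<and> wsrc V x = tgt V (fst p) \<and> wtgt V x = b"
      using Cons.IH x by blast
    moreover have "p # x \<in> words V (length (p # x)) \<longleftrightarrow>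
        fst p \<in> Arr V \<and> snd p < vdim V (fst p) \<and> tgt V (fst p) = wsrc V x \<and>
        x \<in> words V (length x)"
      by (cases p) (auto simp: words_def wsrc_def psrc_def x)
    moreover have "wsrc V (p # x) = src V (fst p)" "wtgt V (p # x) = wtgt V x"
      by (simp_all add: wsrc_def wtgt_def psrc_def ptgt_def x)
    ultimately show ?thesis by auto
  qed
qed simp

lemma walk_unique_ends: "walk V a x b \<Longrightarrow> walk V a' x b' \<Longrightarrow> x \<noteq> [] \<Longrightarrow> a = a' \<and> b = b'"
  by (auto simp: walk_iff_word)

lemma walk_of_word:
  "x \<in> words V m \<Longrightarrow> 0 < m \<Longrightarrow> length x = m \<and> walk V (wsrc V x) x (wtgt V x)"
  by (subst walk_iff_word) (auto simp: words_def)

lemma word_of_walk: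
  "walk V a x b \<Longrightarrow> length x = m \<Longrightarrow> 0 < m \<Longrightarrow> x \<in> words V m \<and> wsrc V x = a \<and> wtgt V x = b"
  by (subst (asm) walk_iff_word) auto

lemma walk_objects:
  assumes "groupoid V" "walk V a x b" "x \<noteq> []"
  shows "a \<in> Obj V" "b \<in> Obj V"
  using assms(2,3)
proof (induction x arbitrary: a)
  case (Cons p x)
  { case 1 with assms(1) show ?case by (auto simp: groupoid_def) }
  { case 2
    with assms(1) Cons.IH(2) show ?case by (cases "x = []") (auto simp: groupoid_def) }
qed auto

lemma finite_letters:
  assumes "groupoid V" "finite_type V"
  shows "finite {p. fst p \<in> Arr V \<and> snd p < vdim V (fst p) \<and> src V (fst p) = a}" (is "finite ?S")
    and "finite {p. fst p \<in> Arr V \<and> snd p < vdim V (fst p) \<and> tgt V (fst p) = a}" (is "finite ?T")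
proof -
  let ?A = "{\<alpha> \<in> Arr V. (src V \<alpha> = a \<or> tgt V \<alpha> = a) \<and> vdim V \<alpha> \<noteq> 0}"
  have "finite ?A"
  proof (cases "a \<in> Obj V")
    case True
    with assms(2) show ?thesis by (simp add: finite_type_def)
  next
    case False
    with assms(1) have "?A = {}" by (auto simp: groupoid_def)
    then show ?thesis by (metis finite.emptyI)
  qed
  then have fin: "finite (SIGMA \<alpha>:?A. {..<vdim V \<alpha>})" by (intro finite_SigmaI) auto
  show "finite ?S" by (rule finite_subset[OF _ fin]) auto
  show "finite ?T" by (rule finite_subset[OF _ fin]) auto
qed

lemma finite_walks_from:
  assumes "groupoid V" "finite_type V"
  shows "finite {x. length x = m \<and> (\<exists>b. walk V a x b)}"
proof (induction m arbitrary: a)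
  case 0
  then show ?case by simp
next
  case (Suc m)
  let ?P = "{p. fst p \<in> Arr V \<and> snd p < vdim V (fst p) \<and> src V (fst p) = a}"
  have "{x. length x = Suc m \<and> (\<exists>b. walk V a x b)} \<subseteq>
      (\<Union>p\<in>?P. Cons p ` {x. length x = m \<and> (\<exists>b. walk V (tgt V (fst p)) x b)})"
  proof
    fix x assume "x \<in> {x. length x = Suc m \<and> (\<exists>b. walk V a x b)}"
    then obtain b where x: "length x = Suc m" "walk V a x b" by auto
    then obtain p y where y: "x = p # y" by (cases x) auto
    with x have "p \<in> ?P" "y \<in> {x. length x = m \<and> (\<exists>b. walk V (tgt V (fst p)) x b)}"
      by auto
    with y show "x \<in> (\<Union>p\<in>?P. Cons p ` {x. length x = m \<and> (\<exists>b. walk V (tgt V (fst p)) x b)})"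
      by blast
  qed
  moreover have "finite \<dots>" using finite_letters(1)[OF assms] Suc.IH by blast
  ultimately show ?case by (rule finite_subset)
qed

lemma finite_walks_to:
  assumes "groupoid V" "finite_type V"
  shows "finite {x. length x = m \<and> (\<exists>a. walk V a x b)}"
proof (induction m arbitrary: b)
  case 0
  then show ?case by simp
next
  case (Suc m)
  let ?P = "{p. fst p \<in> Arr V \<and> snd p < vdim V (fst p) \<and> tgt V (fst p) = b}"
  have "{x. length x = Suc m \<and> (\<exists>a. walk V a x b)} \<subseteq>
      (\<Union>p\<in>?P. (\<lambda>x. x @ [p]) ` {x. length x = m \<and> (\<exists>a. walk V a x (src V (fst p)))})"
  proof
    fix x assume "x \<in> {x. length x = Suc m \<and> (\<exists>a. walk V a x b)}"
    then obtain a where x: "length x = Suc m" "walk V a x b" by auto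
    then obtain y p where y: "x = y @ [p]" by (metis length_Suc_conv_rev)
    with x have "p \<in> ?P" "y \<in> {x. length x = m \<and> (\<exists>a. walk V a x (src V (fst p)))}"
      by (auto simp: walk_append)
    with y show "x \<in> (\<Union>p\<in>?P. (\<lambda>x. x @ [p]) `
        {x. length x = m \<and> (\<exists>a. walk V a x (src V (fst p)))})"
      by blast
  qed
  moreover have "finite \<dots>" using finite_letters(2)[OF assms] Suc.IH by blast
  ultimately show ?case by (rule finite_subset)
qed

lemma is_path_of_walk:
  assumes "walk V a x b" "x \<noteq> []"
  shows "is_path V (map fst x)" "psrc V (map fst x) = a"
  using assms by (auto simp: walk_iff_word is_path_def words_def wsrc_def)

section \<open>Operators that preserve endpoints\<close>

text \<open>The part of being an endomorphism of graded spaces that matters here: all matrix products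
  below are finite, and blocks are preserved, because operators fix the endpoints of words. Unlike
  preservation of degrees, this passes to tensor products without using associativity.\<close>

definition ends_preserving :: "('o, 'a) graded \<Rightarrow> nat \<Rightarrow> ('a, 'a) mat \<Rightarrow> bool" where
  "ends_preserving V m A \<longleftrightarrow> (\<forall>x y. A x y \<noteq> 0 \<longrightarrow>
     length x = m \<and> length y = m \<and> (\<exists>a b. walk V a x b \<and> walk V a y b))"

lemma ends_preservingD:
  assumes "ends_preserving V m A" "A x y \<noteq> 0"
  obtains a b where "length x = m" "length y = m" "walk V a x b" "walk V a y b"
  using assms unfolding ends_preserving_def by blast

lemma ends_preserving_zero:
  assumes "ends_preserving V m A" "\<nexists>a b. length y = m \<and> walk V a y b"
  shows "A x y = 0"
  using assms unfolding ends_preserving_def by blast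

lemma ends_preserving_walk_left:
  assumes "ends_preserving V m A" "A x y \<noteq> 0" "0 < m" "walk V a y b"
  shows "length x = m" "walk V a x b"
proof -
  obtain a' b' where *: "length x = m" "length y = m" "walk V a' x b'" "walk V a' y b'"
    by (rule ends_preservingD[OF assms(1,2)])
  with assms(3) have "y \<noteq> []" by auto
  with * assms(4) have "a' = a" "b' = b" using walk_unique_ends[of V _ y] by blast+
  with * show "length x = m" "walk V a x b" by auto
qed

lemma ends_preserving_walk_right:
  assumes "ends_preserving V m A" "A x y \<noteq> 0" "0 < m" "walk V a x b"
  shows "length y = m" "walk V a y b"
proof -
  obtain a' b' where *: "length x = m" "length y = m" "walk V a' x b'" "walk V a' y b'"
    by (rule ends_preservingD[OF assms(1,2)])
  with assms(3) have "x \<noteq> []" by auto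
  with * assms(4) have "a' = a" "b' = b" using walk_unique_ends[of V _ x] by blast+
  with * show "length y = m" "walk V a y b" by auto
qed

lemma path_arrow_ends:
  assumes "groupoid V" "p \<noteq> []" "set p \<subseteq> Arr V" "successively (\<lambda>\<alpha> \<beta>. tgt V \<alpha> = src V \<beta>) p"
  shows "path_arrow V p \<in> Arr V \<and> src V (path_arrow V p) = psrc V p \<and>
    tgt V (path_arrow V p) = ptgt V p"
  using assms
proof (induction V p rule: path_arrow.induct)
  case (3 V \<alpha> \<beta> p)
  then show ?case
    unfolding groupoid_def by (auto simp: psrc_def ptgt_def)
qed (auto simp: psrc_def ptgt_def)

lemma ends_preserving_if_endo:
  assumes "groupoid V" "0 < m" "endo V m A"
  shows "ends_preserving V m A"
proof -
  have ends: "src V (wdeg V x) = wsrc V x \<and> tgt V (wdeg V x) = wtgt V x" if "x \<in> words V m" for x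
  proof -
    have "map fst x \<noteq> []" "set (map fst x) \<subseteq> Arr V"
      "successively (\<lambda>\<alpha> \<beta>. tgt V \<alpha> = src V \<beta>) (map fst x)"
      using that \<open>0 < m\<close> by (auto simp: words_def)
    from path_arrow_ends[OF assms(1) this] show ?thesis
      by (simp add: wdeg_def wsrc_def wtgt_def)
  qed
  show ?thesis
    unfolding ends_preserving_def
  proof (intro allI impI)
    fix x y assume "A x y \<noteq> 0"
    with assms(3) have *: "x \<in> words V m" "y \<in> words V m" "wdeg V x = wdeg V y"
      by (auto simp: endo_def)
    then have "wsrc V x = wsrc V y" "wtgt V x = wtgt V y" by (metis ends)+
    with * \<open>0 < m\<close> show "length x = m \<and> length y = m \<and> (\<exists>a b. walk V a x b \<and> walk V a y b)"
      by (metis walk_of_word)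
  qed
qed

lemma ends_preserving_idm: "0 < m \<Longrightarrow> ends_preserving V m (idm V m)"
  unfolding ends_preserving_def idm_def using walk_of_word by fastforce

lemma ends_preserving_mmul:
  assumes "ends_preserving V m A" "ends_preserving V m B" "0 < m"
  shows "ends_preserving V m (mmul A B)"
  unfolding ends_preserving_def
proof (intro allI impI)
  fix x z assume "mmul A B x z \<noteq> 0"
  then obtain y where "A x y * B y z \<noteq> 0"
    unfolding mmul_def by (rule Sum_any.not_neutral_obtains_not_neutral)
  then have y: "A x y \<noteq> 0" "B y z \<noteq> 0" by auto
  then obtain a b where "length x = m" "walk V a x b" "walk V a y b"
    by (auto elim: ends_preservingD[OF assms(1)])
  with ends_preserving_walk_right[OF assms(2) y(2) assms(3)]
  show "length x = m \<and> length z = m \<and> (\<exists>a b. walk V a x b \<and> walk V a z b)" by blast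
qed

lemma ends_preserving_tens:
  assumes A: "ends_preserving V p A" and B: "ends_preserving V q B" and "0 < p" "0 < q"
  shows "ends_preserving V (p + q) (tens V V p A B)"
  unfolding ends_preserving_def
proof (intro allI impI)
  fix x y assume "tens V V p A B x y \<noteq> 0"
  then have nz: "joins V p x" "joins V p y" "A (take p x) (take p y) \<noteq> 0"
      "B (drop p x) (drop p y) \<noteq> 0"
    by (auto simp: tens_def split: if_splits)
  obtain a b where 1: "length (take p x) = p" "length (take p y) = p"
      "walk V a (take p x) b" "walk V a (take p y) b"
    using ends_preservingD[OF A nz(3)] by metis
  obtain c d where 2: "length (drop p x) = q" "length (drop p y) = q"
      "walk V c (drop p x) d" "walk V c (drop p y) d"
    using ends_preservingD[OF B nz(4)] by metis
  have "b = c"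
    using word_of_walk[OF 1(3,1) \<open>0 < p\<close>] word_of_walk[OF 2(3,1) \<open>0 < q\<close>] nz(1)
    by (simp add: joins_def)
  then have "walk V a (take p x @ drop p x) d" "walk V a (take p y @ drop p y) d"
    using 1 2 unfolding walk_append by blast+
  then have "walk V a x d" "walk V a y d" by auto
  moreover have "length x = p + q" "length y = p + q" using 1(1,2) 2(1,2) \<open>0 < q\<close> by auto
  ultimately show "length x = p + q \<and> length y = p + q \<and> (\<exists>a b. walk V a x b \<and> walk V a y b)"
    by blast
qed

lemma ends_preserving_op12: "ends_preserving V 2 A \<Longrightarrow> ends_preserving V 3 (op12 V A)"
  using ends_preserving_tens[of V 2 A 1 "idm V 1"] ends_preserving_idm[of 1 V]
  by (simp add: op12_def numeral_3_eq_3)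

lemma ends_preserving_op23: "ends_preserving V 2 A \<Longrightarrow> ends_preserving V 3 (op23 V A)"
  using ends_preserving_tens[of V 1 "idm V 1" 2 A] ends_preserving_idm[of 1 V]
  by (simp add: op23_def numeral_3_eq_3)

text \<open>The range of summation depends on the word \<open>z\<close> only. For families of operators it can
  therefore be chosen independently of the parameter.\<close>

lemma mmul_eq_sum_over_walks:
  assumes "ends_preserving V m B" "0 < m" "walk V a z b"
    and "finite N" "{y. length y = m \<and> walk V a y b} \<subseteq> N"
  shows "mmul A B x z = (\<Sum>y\<in>N. A x y * B y z)"
  unfolding mmul_def
  by (rule Sum_any.expand_superset)
    (use assms ends_preserving_walk_left[OF assms(1) _ assms(2,3)] in auto)

text \<open>In the product the first letter of the intermediate word is forced to be that of \<open>x\<close>, and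
  the composability of the intermediate word follows from that of \<open>x\<close>, as \<open>A\<close> fixes endpoints.\<close>

lemma op23_mmul:
  assumes A: "ends_preserving V 2 A" and B: "ends_preserving V 2 B"
  shows "mmul (op23 V A) (op23 V B) = op23 V (mmul A B)"
proof (intro ext)
  fix x z
  show "mmul (op23 V A) (op23 V B) x z = op23 V (mmul A B) x z"
  proof (cases "joins V 1 x \<and> joins V 1 z \<and> take 1 x = take 1 z \<and> take 1 z \<in> words V 1")
    case True
    define h where "h = take 1 z"
    have h: "take 1 x = h" "take 1 z = h" "h \<in> words V 1" "length h = 1"
      using True by (auto simp: h_def words_def)
    have "mmul (op23 V A) (op23 V B) x z = Sum_any (\<lambda>y. op23 V A x (h @ y) * op23 V B (h @ y) z)"
      unfolding mmul_def
    proof (rule Sum_any_reindex)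
      fix y assume "op23 V A x y * op23 V B y z \<noteq> 0"
      then have "take 1 y = h" using h by (auto simp: op23_def tens_def idm_def split: if_splits)
      then show "y \<in> range (\<lambda>y. h @ y)" by (metis append_take_drop_id rangeI)
    qed (simp add: inj_on_def)
    also have "\<dots> = Sum_any (\<lambda>y. A (drop 1 x) y * B y (drop 1 z))"
    proof (rule Sum_any.cong)
      fix y
      show "op23 V A x (h @ y) * op23 V B (h @ y) z = A (drop 1 x) y * B y (drop 1 z)"
      proof (cases "A (drop 1 x) y = 0")
        case False
        then obtain c d where "length (drop 1 x) = 2" "length y = 2"
            "walk V c (drop 1 x) d" "walk V c y d"
          by (rule ends_preservingD[OF A])
        then have "wsrc V y = wsrc V (drop 1 x)" using word_of_walk by (metis pos2)
        moreover have "wtgt V (take 1 x) = wsrc V (drop 1 x)"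
          using True unfolding joins_def by blast
        ultimately have "joins V 1 (h @ y)" using h unfolding joins_def by simp
        then show ?thesis using True h by (simp add: op23_def tens_def idm_def)
      qed (simp add: op23_def tens_def h)
    qed
    also have "\<dots> = op23 V (mmul A B) x z"
      using True by (simp add: op23_def tens_def idm_def mmul_def)
    finally show ?thesis .
  next
    case False
    have "op23 V A x y * op23 V B y z = 0" for y
      using False by (auto simp: op23_def tens_def idm_def)
    moreover have "op23 V (mmul A B) x z = 0"
      using False by (auto simp: op23_def tens_def idm_def)
    ultimately show ?thesis by (simp only: mmul_def Sum_any.neutral)
  qed
qed

lemma op23_idm:
  fixes V :: "('o, 'a) graded"
  shows "op23 V (idm V 2) = idm V 3"
proof (intro ext)
  fix x y :: "'a word"
  have "joins V 1 y \<and> take 1 y \<in> words V 1 \<and> drop 1 y \<in> words V 2 \<longleftrightarrow> y \<in> words V 3"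
  proof
    assume *: "joins V 1 y \<and> take 1 y \<in> words V 1 \<and> drop 1 y \<in> words V 2"
    then have "walk V (wsrc V (take 1 y)) (take 1 y @ drop 1 y) (wtgt V (drop 1 y))"
      unfolding walk_append joins_def
      using walk_of_word[of "take 1 y" V 1] walk_of_word[of "drop 1 y" V 2] by auto
    moreover have "length y = 3" using * by (auto simp: words_def)
    ultimately show "y \<in> words V 3" using word_of_walk[of V _ y _ 3] by simp
  next
    assume "y \<in> words V 3"
    from walk_of_word[OF this] have len: "length y = 3"
      and "walk V (wsrc V y) (take 1 y @ drop 1 y) (wtgt V y)" by auto
    then obtain c where "walk V (wsrc V y) (take 1 y) c" "walk V c (drop 1 y) (wtgt V y)"
      unfolding walk_append by blast
    with len show "joins V 1 y \<and> take 1 y \<in> words V 1 \<and> drop 1 y \<in> words V 2"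
      using word_of_walk[of V _ "take 1 y" _ 1] word_of_walk[of V _ "drop 1 y" _ 2]
      by (simp add: joins_def)
  qed
  then show "op23 V (idm V 2) x y = idm V 3 x y"
    by (auto simp: op23_def tens_def idm_def) (metis append_take_drop_id)+
qed

text \<open>Prefixing a letter recovers an operator from its action on the last two tensor factors.\<close>

lemma op23_Cons:
  assumes "ends_preserving V 2 A" "walk V c [h] a" "walk V a x b" "walk V a y b"
    "length x = 2" "length y = 2"
  shows "op23 V A (h # x) (h # y) = A x y"
  using assms word_of_walk[of V _ "[h]" _ 1] word_of_walk[of V _ x _ 2] word_of_walk[of V _ y _ 2]
  by (simp add: op23_def tens_def idm_def joins_def)

section \<open>Transfer operators as finite matrices\<close>

locale transfer =
  fixes D :: "('o, 'a, 'q, 'b, 'p) transfer_data"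
  assumes valid: "valid_transfer_data D" and no_multi: "no_multi_edge D"
begin

abbreviation "V \<equiv> sp1 D"
abbreviation "W \<equiv> sp2 D"

lemma graded_spaces: "groupoid V" "finite_type V" "groupoid W" "finite_type W"
  using valid by (auto simp: valid_transfer_data_def)

lemma edge_unique:
  "\<beta> \<in> edges D \<Longrightarrow> \<beta>' \<in> edges D \<Longrightarrow> esrc D \<beta> = esrc D \<beta>' \<Longrightarrow> etgt D \<beta> = etgt D \<beta>' \<Longrightarrow> \<beta> = \<beta>'"
  using no_multi by (auto simp: no_multi_edge_def)

text \<open>The index sets of the blocks: words along the upper and the lower route from \<open>a\<close> to \<open>c\<close>, where
  the first groupoid is drawn above the second. The edge is listed last in both cases.\<close>

definition upper :: "nat \<Rightarrow> 'o \<Rightarrow> 'q \<Rightarrow> ('a word \<times> 'p) set" where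
  "upper m a c = {(v, \<beta>). \<beta> \<in> edges D \<and> length v = m \<and> walk V a v (esrc D \<beta>) \<and> etgt D \<beta> = c}"

definition lower :: "nat \<Rightarrow> 'o \<Rightarrow> 'q \<Rightarrow> ('b word \<times> 'p) set" where
  "lower m a c = {(w, \<beta>). \<beta> \<in> edges D \<and> esrc D \<beta> = a \<and> length w = m \<and> walk W (etgt D \<beta>) w c}"

text \<open>A word on the upper route determines its edge, whose source and target are both known; in
  the same way for the lower route.\<close>

lemma finite_upper: "finite (upper m a c)"
proof (rule finite_imageD)
  show "finite (fst ` upper m a c)"
    by (rule finite_subset[OF _ finite_walks_from[OF graded_spaces(1,2), of m a]]) (auto simp: upper_def)
  show "inj_on fst (upper m a c)"
    by (auto simp: upper_def inj_on_def intro: edge_unique dest: walk_functional)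
qed

lemma finite_lower: "finite (lower m a c)"
proof (rule finite_imageD)
  show "finite (fst ` lower m a c)"
    by (rule finite_subset[OF _ finite_walks_to[OF graded_spaces(3,4), of m c]]) (auto simp: lower_def)
  show "inj_on fst (lower m a c)"
    by (auto simp: lower_def inj_on_def intro: edge_unique dest: walk_functional_left)
qed

lemma Gamma_WV_walks:
  assumes "g \<in> Gamma_WV D m" "0 < m" "\<beta>1 \<in> edges D" "\<beta>2 \<in> edges D" "g \<beta>1 \<beta>2 v w \<noteq> 0"
  shows "length v = m" "walk V (esrc D \<beta>1) v (esrc D \<beta>2)"
    "length w = m" "walk W (etgt D \<beta>1) w (etgt D \<beta>2)"
proof -
  have "v \<in> words V m \<and> w \<in> words W m \<and> wsrc V v = esrc D \<beta>1 \<and> wtgt V v = esrc D \<beta>2 \<and>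
     wsrc W w = etgt D \<beta>1 \<and> wtgt W w = etgt D \<beta>2"
    using assms unfolding Gamma_WV_def by blast
  with walk_of_word[of v V m] walk_of_word[of w W m] \<open>0 < m\<close>
  show "length v = m" "walk V (esrc D \<beta>1) v (esrc D \<beta>2)"
    "length w = m" "walk W (etgt D \<beta>1) w (etgt D \<beta>2)" by auto
qed

lemma Gamma_VW_walks:
  assumes "f \<in> Gamma_VW D m" "0 < m" "\<beta>1 \<in> edges D" "\<beta>2 \<in> edges D" "f \<beta>1 \<beta>2 w v \<noteq> 0"
  shows "length v = m" "walk V (esrc D \<beta>2) v (esrc D \<beta>1)"
    "length w = m" "walk W (etgt D \<beta>2) w (etgt D \<beta>1)"
proof -
  have "w \<in> words W m \<and> v \<in> words V m \<and> wsrc V v = esrc D \<beta>2 \<and> wtgt V v = esrc D \<beta>1 \<and>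
     wsrc W w = etgt D \<beta>2 \<and> wtgt W w = etgt D \<beta>1"
    using assms unfolding Gamma_VW_def by blast
  with walk_of_word[of v V m] walk_of_word[of w W m] \<open>0 < m\<close>
  show "length v = m" "walk V (esrc D \<beta>2) v (esrc D \<beta>1)"
    "length w = m" "walk W (etgt D \<beta>2) w (etgt D \<beta>1)" by auto
qed

definition WV_block ::
  "('p \<Rightarrow> 'p \<Rightarrow> ('a, 'b) mat) \<Rightarrow> 'a word \<times> 'p \<Rightarrow> 'b word \<times> 'p \<Rightarrow> complex" where
  "WV_block g p q = g (snd q) (snd p) (fst p) (fst q)"

definition VW_block ::
  "('p \<Rightarrow> 'p \<Rightarrow> ('b, 'a) mat) \<Rightarrow> 'b word \<times> 'p \<Rightarrow> 'a word \<times> 'p \<Rightarrow> complex" where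
  "VW_block f q p = f (snd p) (snd q) (fst q) (fst p)"

text \<open>The sum over the edges combines with the matrix product into a single sum over the lower
  route, because a nonzero entry of \<open>g\<close> forces the edge to start at \<open>a\<close> and the word to end at \<open>c\<close>.\<close>

lemma right_inverse_block:
  assumes "right_inverse D m g f" "0 < m" "p \<in> upper m a c" "p' \<in> upper m a c"
  shows "(\<Sum>q\<in>lower m a c. WV_block g p q * VW_block f q p') = of_bool (p = p')"
proof -
  obtain v \<beta> where p: "p = (v, \<beta>)" "\<beta> \<in> edges D" "etgt D \<beta> = c" "length v = m"
      "walk V a v (esrc D \<beta>)"
    using assms(3) by (auto simp: upper_def)
  obtain v' \<beta>' where p': "p' = (v', \<beta>')" "\<beta>' \<in> edges D" "etgt D \<beta>' = c" "length v' = m"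
      "walk V a v' (esrc D \<beta>')"
    using assms(4) by (auto simp: upper_def)
  have g: "g \<in> Gamma_WV D m" and f: "f \<in> Gamma_VW D m"
    using assms(1) by (auto simp: right_inverse_def)
  have v': "v' \<in> words V m" "wtgt V v' = esrc D \<beta>'" using word_of_walk[OF p'(5,4) assms(2)] by auto
  have "(\<Sum>q\<in>lower m a c. WV_block g p q * VW_block f q p') =
      Sum_any (\<lambda>\<epsilon>. Sum_any (\<lambda>w. if \<epsilon> \<in> edges D then g \<epsilon> \<beta> v w * f \<beta>' \<epsilon> w v' else 0))"
  proof (subst Sum_any_pairs[OF finite_lower[of m a c]])
    fix \<epsilon> w assume "(if \<epsilon> \<in> edges D then g \<epsilon> \<beta> v w * f \<beta>' \<epsilon> w v' else 0) \<noteq> 0"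
    then have *: "\<epsilon> \<in> edges D" "g \<epsilon> \<beta> v w \<noteq> 0" by (auto split: if_splits)
    from Gamma_WV_walks[OF g assms(2) *(1) p(2) *(2)] p walk_functional_left[of V _ v] *(1)
    show "(w, \<epsilon>) \<in> lower m a c" by (auto simp: lower_def)
  qed (auto simp: p p' WV_block_def VW_block_def lower_def intro!: sum.cong)
  also have "\<dots> = edge_sum D (\<lambda>\<epsilon>. mmul (g \<epsilon> \<beta>) (f \<beta>' \<epsilon>)) v v'"
    unfolding edge_sum_def mmul_def by (intro Sum_any.cong) auto
  also have "\<dots> = (if \<beta>' = \<beta> then id_VW D m \<beta>' else (\<lambda>_ _. 0)) v v'"
    using assms(1) p p' by (simp add: right_inverse_def)
  also have "\<dots> = of_bool (p = p')" using v' by (auto simp: id_VW_def p p')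
  finally show ?thesis .
qed

lemma left_inverse_block:
  assumes "left_inverse D m g f" "0 < m" "q \<in> lower m a c" "q' \<in> lower m a c"
  shows "(\<Sum>p\<in>upper m a c. VW_block f q p * WV_block g p q') = of_bool (q = q')"
proof -
  obtain w \<beta> where q: "q = (w, \<beta>)" "\<beta> \<in> edges D" "esrc D \<beta> = a" "length w = m"
      "walk W (etgt D \<beta>) w c"
    using assms(3) by (auto simp: lower_def)
  obtain w' \<beta>' where q': "q' = (w', \<beta>')" "\<beta>' \<in> edges D" "esrc D \<beta>' = a" "length w' = m"
      "walk W (etgt D \<beta>') w' c"
    using assms(4) by (auto simp: lower_def)
  have g: "g \<in> Gamma_WV D m" and f: "f \<in> Gamma_VW D m"
    using assms(1) by (auto simp: left_inverse_def)
  have w': "w' \<in> words W m" "wsrc W w' = etgt D \<beta>'" using word_of_walk[OF q'(5,4) assms(2)] by auto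
  have "(\<Sum>p\<in>upper m a c. VW_block f q p * WV_block g p q') =
      Sum_any (\<lambda>\<epsilon>. Sum_any (\<lambda>v. if \<epsilon> \<in> edges D then f \<epsilon> \<beta> w v * g \<beta>' \<epsilon> v w' else 0))"
  proof (subst Sum_any_pairs[OF finite_upper[of m a c]])
    fix \<epsilon> v assume "(if \<epsilon> \<in> edges D then f \<epsilon> \<beta> w v * g \<beta>' \<epsilon> v w' else 0) \<noteq> 0"
    then have *: "\<epsilon> \<in> edges D" "f \<epsilon> \<beta> w v \<noteq> 0" by (auto split: if_splits)
    from Gamma_VW_walks[OF f assms(2) *(1) q(2) *(2)] q walk_functional[of W _ w] *(1)
    show "(v, \<epsilon>) \<in> upper m a c" by (auto simp: upper_def)
  qed (auto simp: q q' WV_block_def VW_block_def upper_def intro!: sum.cong)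
  also have "\<dots> = circ D f g \<beta>' \<beta> w w'"
    unfolding circ_def edge_sum_def mmul_def by (intro Sum_any.cong) auto
  also have "\<dots> = (if \<beta>' = \<beta> then id_WV D m \<beta>' else (\<lambda>_ _. 0)) w w'"
    using assms(1) q q' by (simp add: left_inverse_def)
  also have "\<dots> = of_bool (q = q')" using w' by (auto simp: id_WV_def q q')
  finally show ?thesis .
qed

lemma card_upper_le_lower:
  "right_inverse D m g f \<Longrightarrow> 0 < m \<Longrightarrow> card (upper m a c) \<le> card (lower m a c)"
  using right_inverse_block
  by (rule card_le_if_right_inverse[OF finite_upper finite_lower,
      where G = "WV_block g" and F = "VW_block f"])

lemma card_lower_le_upper:
  "left_inverse D m g f \<Longrightarrow> 0 < m \<Longrightarrow> card (lower m a c) \<le> card (upper m a c)"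
  using left_inverse_block
  by (rule card_le_if_right_inverse[OF finite_lower finite_upper,
      where G = "VW_block f" and F = "WV_block g"])

section \<open>Conjugation by a transfer operator\<close>

text \<open>The matrix product \<open>F Q G\<close>, where \<open>Q\<close> acts on the words of the upper route and leaves the edge
  alone.\<close>

definition sandwich ::
  "nat \<Rightarrow> 'o \<Rightarrow> 'q \<Rightarrow> ('p \<Rightarrow> 'p \<Rightarrow> ('a, 'b) mat) \<Rightarrow> ('p \<Rightarrow> 'p \<Rightarrow> ('b, 'a) mat) \<Rightarrow> ('a, 'a) mat \<Rightarrow>
   'b word \<times> 'p \<Rightarrow> 'b word \<times> 'p \<Rightarrow> complex" where
  "sandwich m a c g f Q q q' =
     (\<Sum>p\<in>upper m a c. \<Sum>p'\<in>upper m a c.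
        VW_block f q p * (of_bool (snd p = snd p') * Q (fst p) (fst p')) * WV_block g p' q')"

text \<open>A word that \<open>g\<close> produces from \<open>y\<close> lies, with the edge it leads to, on the upper route between the
  same objects, and \<open>Q\<close> keeps it there. So the sums over edges and words are sums over blocks.\<close>

lemma circ_op_act_eq_sandwich:
  assumes g: "g \<in> Gamma_WV D m" and f: "f \<in> Gamma_VW D m" and m: "0 < m"
    and Q: "ends_preserving V m Q"
    and y: "(y, \<beta>) \<in> lower m a c" and \<beta>': "\<beta>' \<in> edges D"
  shows "circ D f (op_act Q g) \<beta> \<beta>' x y = sandwich m a c g f Q (x, \<beta>') (y, \<beta>)"
proof -
  have \<beta>: "\<beta> \<in> edges D" "esrc D \<beta> = a" "length y = m" "walk W (etgt D \<beta>) y c"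
    using y by (auto simp: lower_def)
  have v_upper: "(v, \<epsilon>) \<in> upper m a c" if "\<epsilon> \<in> edges D" "g \<beta> \<epsilon> v y \<noteq> 0" for \<epsilon> v
    using Gamma_WV_walks[OF g m \<beta>(1) that] \<beta> that walk_functional[of W _ y]
    by (auto simp: upper_def)
  have u_upper: "(u, \<epsilon>) \<in> upper m a c" if "\<epsilon> \<in> edges D" "Q u v * g \<beta> \<epsilon> v y \<noteq> 0" for \<epsilon> u v
  proof -
    have "(v, \<epsilon>) \<in> upper m a c" "Q u v \<noteq> 0" using v_upper that by auto
    then show ?thesis using ends_preserving_walk_left[OF Q _ m, of u v] by (auto simp: upper_def)
  qed
  have inner: "mmul Q (g \<beta> \<epsilon>) u y =
      (\<Sum>p'\<in>upper m a c. of_bool (snd p' = \<epsilon>) * (Q u (fst p') * g \<beta> \<epsilon> (fst p') y))"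
    if "\<epsilon> \<in> edges D" for \<epsilon> u
    unfolding mmul_def using that v_upper by (intro Sum_any_fibre[OF finite_upper]) auto
  have "circ D f (op_act Q g) \<beta> \<beta>' x y =
      Sum_any (\<lambda>\<epsilon>. Sum_any (\<lambda>u. if \<epsilon> \<in> edges D then f \<epsilon> \<beta>' x u * mmul Q (g \<beta> \<epsilon>) u y else 0))"
    unfolding circ_def edge_sum_def op_act_def mmul_def[of "f _ _"] by (intro Sum_any.cong) auto
  also have "\<dots> = (\<Sum>p\<in>upper m a c. if snd p \<in> edges D
      then f (snd p) \<beta>' x (fst p) * mmul Q (g \<beta> (snd p)) (fst p) y else 0)"
  proof (rule Sum_any_pairs[OF finite_upper])
    fix \<epsilon> u assume "(if \<epsilon> \<in> edges D then f \<epsilon> \<beta>' x u * mmul Q (g \<beta> \<epsilon>) u y else 0) \<noteq> 0"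
    then have *: "\<epsilon> \<in> edges D" "mmul Q (g \<beta> \<epsilon>) u y \<noteq> 0" by (auto split: if_splits)
    from *(2) obtain v where "Q u v * g \<beta> \<epsilon> v y \<noteq> 0"
      unfolding mmul_def by (rule Sum_any.not_neutral_obtains_not_neutral)
    then show "(u, \<epsilon>) \<in> upper m a c" using u_upper *(1) by blast
  qed
  also have "\<dots> = sandwich m a c g f Q (x, \<beta>') (y, \<beta>)"
    unfolding sandwich_def
  proof (rule sum.cong[OF refl])
    fix p assume "p \<in> upper m a c"
    then have "snd p \<in> edges D" by (auto simp: upper_def)
    then show "(if snd p \<in> edges D
        then f (snd p) \<beta>' x (fst p) * mmul Q (g \<beta> (snd p)) (fst p) y else 0) =
      (\<Sum>p'\<in>upper m a c. VW_block f (x, \<beta>') p *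
        (of_bool (snd p = snd p') * Q (fst p) (fst p')) * WV_block g p' (y, \<beta>))"
      by (auto simp: inner sum_distrib_left VW_block_def WV_block_def intro!: sum.cong)
  qed
  finally show ?thesis .
qed

text \<open>In \<open>F Q G F Q' G\<close> the middle factor \<open>G F\<close> is the identity. That \<open>Q'\<close> fixes endpoints ensures
  that no intermediate word of the product \<open>Q Q'\<close> leaves the block.\<close>

lemma sandwich_mmul:
  assumes inv: "right_inverse D m g f" and m: "0 < m"
    and Q': "ends_preserving V m Q'"
  shows "(\<Sum>r\<in>lower m a c. sandwich m a c g f Q q r * sandwich m a c g f Q' r q') =
    sandwich m a c g f (mmul Q Q') q q'"
proof -
  let ?X = "upper m a c" and ?Y = "lower m a c"
  let ?hat = "\<lambda>Q p p'. of_bool (snd p = snd p') * (Q (fst p) (fst p') :: complex)"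
  \<comment> \<open>the row \<open>F Q\<close> at \<open>q\<close> and the column \<open>Q' G\<close> at \<open>q'\<close>\<close>
  define L where "L p' = (\<Sum>p\<in>?X. VW_block f q p * ?hat Q p p')" for p'
  define M where "M p = (\<Sum>p'\<in>?X. ?hat Q' p p' * WV_block g p' q')" for p
  have 1: "sandwich m a c g f Q q r = (\<Sum>p'\<in>?X. L p' * WV_block g p' r)" for r
    unfolding sandwich_def L_def sum_distrib_right by (rule sum.swap)
  have 2: "sandwich m a c g f Q' r q' = (\<Sum>p\<in>?X. VW_block f r p * M p)" for r
    unfolding sandwich_def M_def sum_distrib_left by (simp add: mult.assoc)
  have "(\<Sum>r\<in>?Y. sandwich m a c g f Q q r * sandwich m a c g f Q' r q') =
      (\<Sum>r\<in>?Y. \<Sum>p'\<in>?X. \<Sum>s\<in>?X. L p' * M s * (WV_block g p' r * VW_block f r s))"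
    unfolding 1 2 sum_product by (intro sum.cong refl) (simp add: mult_ac)
  also have "\<dots> = (\<Sum>p'\<in>?X. \<Sum>s\<in>?X. L p' * M s * (\<Sum>r\<in>?Y. WV_block g p' r * VW_block f r s))"
    unfolding sum_distrib_left
    by (subst sum.swap) (intro sum.cong[OF refl] sum.swap)
  also have "\<dots> = (\<Sum>p'\<in>?X. \<Sum>s\<in>?X. L p' * M s * of_bool (p' = s))"
    by (intro sum.cong refl) (simp add: right_inverse_block[OF inv m])
  also have "\<dots> = (\<Sum>p'\<in>?X. L p' * M p')"
    by (intro sum.cong refl) (simp add: of_bool_def if_distrib sum.delta finite_upper cong: if_cong)
  also have "\<dots> = (\<Sum>p'\<in>?X. \<Sum>p\<in>?X. \<Sum>s\<in>?X.
      VW_block f q p * (?hat Q p p' * ?hat Q' p' s) * WV_block g s q')"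
    unfolding L_def M_def sum_product by (intro sum.cong refl) (simp add: mult_ac)
  also have "\<dots> = (\<Sum>p\<in>?X. \<Sum>s\<in>?X. \<Sum>p'\<in>?X.
      VW_block f q p * (?hat Q p p' * ?hat Q' p' s) * WV_block g s q')"
    by (subst sum.swap) (intro sum.cong[OF refl] sum.swap)
  also have "\<dots> = (\<Sum>p\<in>?X. \<Sum>s\<in>?X. VW_block f q p *
      (\<Sum>p'\<in>?X. ?hat Q p p' * ?hat Q' p' s) * WV_block g s q')"
    by (simp add: sum_distrib_left sum_distrib_right)
  also have "\<dots> = (\<Sum>p\<in>?X. \<Sum>s\<in>?X. VW_block f q p * ?hat (mmul Q Q') p s * WV_block g s q')"
  proof (intro sum.cong refl arg_cong2[where f = "(*)"])
    fix p s assume ps: "p \<in> ?X" "s \<in> ?X"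
    have "mmul Q Q' (fst p) (fst s) =
        (\<Sum>p'\<in>?X. of_bool (snd p' = snd s) * (Q (fst p) (fst p') * Q' (fst p') (fst s)))"
      unfolding mmul_def
    proof (rule Sum_any_fibre[OF finite_upper])
      fix u assume "Q (fst p) u * Q' u (fst s) \<noteq> 0"
      then have "Q' u (fst s) \<noteq> 0" by simp
      from ends_preserving_walk_left[OF Q' this m] ps(2) show "(u, snd s) \<in> ?X"
        by (auto simp: upper_def)
    qed
    then show "(\<Sum>p'\<in>?X. ?hat Q p p' * ?hat Q' p' s) = ?hat (mmul Q Q') p s"
      by (cases "snd p = snd s") (auto intro!: sum.cong sum.neutral)
  qed
  finally show ?thesis by (simp add: sandwich_def)
qed

text \<open>On the words at the edge \<open>\<beta>\<close> the conjugate of \<open>Q\<close> acts as \<open>A\<close>, without components that lead to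
  other edges out of the same object. This is the form of the weight zero condition.\<close>

definition implements ::
  "nat \<Rightarrow> ('p \<Rightarrow> 'p \<Rightarrow> ('a, 'b) mat) \<Rightarrow> ('p \<Rightarrow> 'p \<Rightarrow> ('b, 'a) mat) \<Rightarrow> 'p \<Rightarrow>
   ('a, 'a) mat \<Rightarrow> ('b, 'b) mat \<Rightarrow> bool" where
  "implements m g f \<beta> Q A \<longleftrightarrow> (\<forall>c x y \<beta>'.
     (y, \<beta>) \<in> lower m (esrc D \<beta>) c \<longrightarrow> (x, \<beta>') \<in> lower m (esrc D \<beta>) c \<longrightarrow>
     sandwich m (esrc D \<beta>) c g f Q (x, \<beta>') (y, \<beta>) = A x y * of_bool (\<beta> = \<beta>'))"

text \<open>The intermediate sum runs over all edges out of the source of \<open>\<beta>\<close>; as the second factor has no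
  components that leave \<open>\<beta>\<close>, only those at \<open>\<beta>\<close> survive.\<close>

lemma implements_mmul:
  assumes inv: "right_inverse D m g f" and m: "0 < m"
    and Q': "ends_preserving V m Q'" and A': "ends_preserving W m A'"
    and QA: "implements m g f \<beta> Q A" and QA': "implements m g f \<beta> Q' A'"
  shows "implements m g f \<beta> (mmul Q Q') (mmul A A')"
  unfolding implements_def
proof (intro allI impI)
  fix c x y \<beta>'
  let ?Y = "lower m (esrc D \<beta>) c" and ?T = "sandwich m (esrc D \<beta>) c g f"
  assume y: "(y, \<beta>) \<in> ?Y" and x: "(x, \<beta>') \<in> ?Y"
  have "?T (mmul Q Q') (x, \<beta>') (y, \<beta>) = (\<Sum>r\<in>?Y. ?T Q (x, \<beta>') r * ?T Q' r (y, \<beta>))"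
    by (rule sandwich_mmul[OF inv m Q', symmetric])
  also have "\<dots> = (\<Sum>r\<in>?Y. of_bool (snd r = \<beta>) * (A x (fst r) * A' (fst r) y) * of_bool (\<beta> = \<beta>'))"
  proof (rule sum.cong[OF refl])
    fix r assume r: "r \<in> ?Y"
    then have 2: "?T Q' r (y, \<beta>) = A' (fst r) y * of_bool (\<beta> = snd r)"
      using QA' y unfolding implements_def by (metis prod.collapse)
    show "?T Q (x, \<beta>') r * ?T Q' r (y, \<beta>) =
        of_bool (snd r = \<beta>) * (A x (fst r) * A' (fst r) y) * of_bool (\<beta> = \<beta>')"
    proof (cases "snd r = \<beta>")
      case True
      with r have "?T Q (x, \<beta>') r = A x (fst r) * of_bool (\<beta> = \<beta>')"
        using QA x unfolding implements_def by (metis prod.collapse)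
      with 2 True show ?thesis by simp
    qed (use 2 in simp)
  qed
  also have "\<dots> = mmul A A' x y * of_bool (\<beta> = \<beta>')"
    unfolding sum_distrib_right[symmetric] mmul_def
  proof (subst Sum_any_fibre[OF finite_lower[of m "esrc D \<beta>" c]])
    fix t assume "A x t * A' t y \<noteq> 0"
    then have "A' t y \<noteq> 0" by simp
    from ends_preserving_walk_left[OF A' this m] y show "(t, \<beta>) \<in> ?Y" by (auto simp: lower_def)
  qed simp
  finally show "?T (mmul Q Q') (x, \<beta>') (y, \<beta>) = mmul A A' x y * of_bool (\<beta> = \<beta>')" .
qed

text \<open>Here the block matrices have to be two-sided inverses of each other, which is where the
  cardinalities of their index sets enter.\<close>

lemma implements_idm:
  assumes inv: "right_inverse D m g f" and m: "0 < m"
    and card: "\<And>c. card (lower m (esrc D \<beta>) c) \<le> card (upper m (esrc D \<beta>) c)"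
  shows "implements m g f \<beta> (idm V m) (idm W m)"
  unfolding implements_def
proof (intro allI impI)
  fix c x y \<beta>'
  let ?X = "upper m (esrc D \<beta>) c" and ?Y = "lower m (esrc D \<beta>) c"
  assume y: "(y, \<beta>) \<in> ?Y" and x: "(x, \<beta>') \<in> ?Y"
  have "sandwich m (esrc D \<beta>) c g f (idm V m) (x, \<beta>') (y, \<beta>) =
      (\<Sum>p\<in>?X. \<Sum>p'\<in>?X. if p = p' then VW_block f (x, \<beta>') p * WV_block g p' (y, \<beta>) else 0)"
    unfolding sandwich_def
  proof (intro sum.cong refl)
    fix p p' assume "p \<in> ?X" "p' \<in> ?X"
    then have "fst p' \<in> words V m"
      using word_of_walk[of V _ "fst p'" _ m] m by (auto simp: upper_def)
    then have "of_bool (snd p = snd p') * idm V m (fst p) (fst p') = of_bool (p = p')"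
      by (auto simp: idm_def prod_eq_iff)
    then show "VW_block f (x, \<beta>') p * (of_bool (snd p = snd p') * idm V m (fst p) (fst p')) *
        WV_block g p' (y, \<beta>) = (if p = p' then VW_block f (x, \<beta>') p * WV_block g p' (y, \<beta>) else 0)"
      by simp
  qed
  also have "\<dots> = (\<Sum>p\<in>?X. VW_block f (x, \<beta>') p * WV_block g p (y, \<beta>))"
    by (simp add: finite_upper)
  also have "\<dots> = of_bool ((x, \<beta>') = (y, \<beta>))"
    by (rule right_inverse_of_tall_matrix(2)[OF finite_upper finite_lower card
          right_inverse_block[OF inv m] x y])
  also have "\<dots> = idm W m x y * of_bool (\<beta> = \<beta>')"
    using y m word_of_walk[of W _ y _ m] by (auto simp: idm_def lower_def)
  finally show "sandwich m (esrc D \<beta>) c g f (idm V m) (x, \<beta>') (y, \<beta>) =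
    idm W m x y * of_bool (\<beta> = \<beta>')" .
qed

section \<open>Counting zigzags\<close>

text \<open>The edge may be crossed anywhere along the way: \<open>upper\<close> and \<open>lower\<close> are the cases in which the
  second, respectively the first, walk is empty.\<close>

definition zigzags :: "nat \<Rightarrow> nat \<Rightarrow> 'o \<Rightarrow> 'q \<Rightarrow> ('a word \<times> 'p \<times> 'b word) set" where
  "zigzags i m a c = {(v, \<beta>, w). \<beta> \<in> edges D \<and> length v = i \<and> walk V a v (esrc D \<beta>) \<and>
     length w = m \<and> walk W (etgt D \<beta>) w c}"

text \<open>The outer parts of a zigzag, with their inner endpoints. Completing a frame by an upper or a
  lower path between these endpoints produces a zigzag, and all zigzags of the right lengths
  arise once in this way.\<close>

definition frames :: "nat \<Rightarrow> nat \<Rightarrow> 'o \<Rightarrow> 'q \<Rightarrow> (('a word \<times> 'o) \<times> ('b word \<times> 'q)) set" where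
  "frames i m a c =
     {(v, a'). length v = i \<and> walk V a v a'} \<times> {(w, c'). length w = m \<and> walk W c' w c}"

lemma finite_frames: "finite (frames i m a c)"
proof -
  have "finite {(v, a'). length v = i \<and> walk V a v a'}"
  proof (rule finite_imageD)
    show "finite (fst ` {(v, a'). length v = i \<and> walk V a v a'})"
      by (rule finite_subset[OF _ finite_walks_from[OF graded_spaces(1,2), of i a]]) auto
  qed (auto simp: inj_on_def dest: walk_functional)
  moreover have "finite {(w, c'). length w = m \<and> walk W c' w c}"
  proof (rule finite_imageD)
    show "finite (fst ` {(w, c'). length w = m \<and> walk W c' w c})"
      by (rule finite_subset[OF _ finite_walks_to[OF graded_spaces(3,4), of m c]]) auto
  qed (auto simp: inj_on_def dest: walk_functional_left)
  ultimately show ?thesis by (simp add: frames_def)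
qed

lemma card_zigzags_lower:
  "card (zigzags i (r + m) a c) = (\<Sum>((v, a'), (w, c'))\<in>frames i m a c. card (lower r a' c'))"
proof -
  let ?S = "SIGMA e:frames i m a c. lower r (snd (fst e)) (snd (snd e))"
  let ?\<phi> = "\<lambda>(((v, a'), (w, c')), (u, \<beta>)). (v, \<beta>, u @ w)"
  have inj: "inj_on ?\<phi> ?S"
    by (auto simp: inj_on_def frames_def lower_def) (metis walk_functional_left)+
  have image: "?\<phi> ` ?S = zigzags i (r + m) a c"
  proof
    show "?\<phi> ` ?S \<subseteq> zigzags i (r + m) a c"
      by (force simp: frames_def lower_def zigzags_def walk_append)
    show "zigzags i (r + m) a c \<subseteq> ?\<phi> ` ?S"
    proof
      fix t assume "t \<in> zigzags i (r + m) a c"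
      then obtain v \<beta> w where t: "t = (v, \<beta>, w)" "\<beta> \<in> edges D" "length v = i"
          "walk V a v (esrc D \<beta>)" "length w = r + m" "walk W (etgt D \<beta>) (take r w @ drop r w) c"
        by (auto simp: zigzags_def)
      then obtain c' where c': "walk W (etgt D \<beta>) (take r w) c'" "walk W c' (drop r w) c"
        unfolding walk_append by blast
      have "(((v, esrc D \<beta>), (drop r w, c')), (take r w, \<beta>)) \<in> ?S"
        using t c' by (auto simp: frames_def lower_def)
      from imageI[OF this, of ?\<phi>] show "t \<in> ?\<phi> ` ?S" using t(1) by simp
    qed
  qed
  have "card (zigzags i (r + m) a c) = card ?S"
    unfolding image[symmetric] by (rule card_image[OF inj])
  also have "\<dots> = (\<Sum>e\<in>frames i m a c. card (lower r (snd (fst e)) (snd (snd e))))"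
    by (rule card_SigmaI) (auto simp: finite_frames finite_lower)
  finally show ?thesis by (simp add: case_prod_unfold)
qed

lemma card_zigzags_upper:
  "card (zigzags (i + r) m a c) = (\<Sum>((v, a'), (w, c'))\<in>frames i m a c. card (upper r a' c'))"
proof -
  let ?S = "SIGMA e:frames i m a c. upper r (snd (fst e)) (snd (snd e))"
  let ?\<phi> = "\<lambda>(((v, a'), (w, c')), (u, \<beta>)). (v @ u, \<beta>, w)"
  have inj: "inj_on ?\<phi> ?S"
    by (auto simp: inj_on_def frames_def upper_def) (metis walk_functional)+
  have image: "?\<phi> ` ?S = zigzags (i + r) m a c"
  proof
    show "?\<phi> ` ?S \<subseteq> zigzags (i + r) m a c"
      by (force simp: frames_def upper_def zigzags_def walk_append)
    show "zigzags (i + r) m a c \<subseteq> ?\<phi> ` ?S"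
    proof
      fix t assume "t \<in> zigzags (i + r) m a c"
      then obtain v \<beta> w where t: "t = (v, \<beta>, w)" "\<beta> \<in> edges D" "length v = i + r"
          "walk V a (take i v @ drop i v) (esrc D \<beta>)" "length w = m" "walk W (etgt D \<beta>) w c"
        by (auto simp: zigzags_def)
      then obtain a' where a': "walk V a (take i v) a'" "walk V a' (drop i v) (esrc D \<beta>)"
        unfolding walk_append by blast
      have "(((take i v, a'), (w, etgt D \<beta>)), (drop i v, \<beta>)) \<in> ?S"
        using t a' by (auto simp: frames_def upper_def)
      from imageI[OF this, of ?\<phi>] show "t \<in> ?\<phi> ` ?S" using t(1) by simp
    qed
  qed
  have "card (zigzags (i + r) m a c) = card ?S"
    unfolding image[symmetric] by (rule card_image[OF inj])
  also have "\<dots> = (\<Sum>e\<in>frames i m a c. card (upper r (snd (fst e)) (snd (snd e))))"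
    by (rule card_SigmaI) (auto simp: finite_frames finite_upper)
  finally show ?thesis by (simp add: case_prod_unfold)
qed

lemma finite_zigzags: "finite (zigzags i m a c)"
proof (rule finite_imageD)
  show "finite ((\<lambda>(v, \<beta>, w). ((v, esrc D \<beta>), (w, etgt D \<beta>))) ` zigzags i m a c)"
    by (rule finite_subset[OF _ finite_frames[of i m a c]]) (auto simp: zigzags_def frames_def)
qed (auto simp: inj_on_def zigzags_def intro: edge_unique)

text \<open>Inequalities between lower and upper paths, summed over all frames, compare the numbers of
  zigzags that cross at different places.\<close>

lemma zigzags_push:
  assumes "\<And>a c. card (lower k a c) \<le> card (upper k a c)"
  shows "card (zigzags i (n * k + m) a c) \<le> card (zigzags (i + n * k) m a c)"
proof (induction n arbitrary: i)
  case (Suc n)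
  have "card (zigzags i (Suc n * k + m) a c) = card (zigzags i (k + (n * k + m)) a c)"
    by (simp add: add.assoc)
  also have "\<dots> \<le> card (zigzags (i + k) (n * k + m) a c)"
    unfolding card_zigzags_lower[of i k] card_zigzags_upper[of i k]
    by (intro sum_mono) (auto intro: assms)
  also have "\<dots> \<le> card (zigzags (i + Suc n * k) m a c)"
    using Suc.IH[of "i + k"] by (simp add: add.assoc)
  finally show ?case .
qed simp

lemma zigzags_pull:
  assumes "\<And>a c. card (upper r a c) \<le> card (lower r a c)"
  shows "card (zigzags (i + n * r) m a c) \<le> card (zigzags i (n * r + m) a c)"
proof (induction n arbitrary: m)
  case (Suc n)
  have "card (zigzags (i + Suc n * r) m a c) = card (zigzags ((i + n * r) + r) m a c)"
    by (simp add: add_ac)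
  also have "\<dots> \<le> card (zigzags (i + n * r) (r + m) a c)"
    unfolding card_zigzags_lower[of _ r] card_zigzags_upper[of _ r m]
    by (intro sum_mono) (auto intro: assms)
  also have "\<dots> \<le> card (zigzags i (Suc n * r + m) a c)"
    using Suc.IH[of "r + m"] by (simp add: add_ac)
  finally show ?case .
qed simp

text \<open>Among zigzags of total length \<open>(n + 1) r\<close> from \<open>a\<close> to \<open>c\<close>, the crossing can be moved from the
  start to the end by \<open>r\<close> jumps of \<open>n + 1\<close>, and back by \<open>n + 1\<close> jumps of \<open>r\<close>. The inequalities
  close up to a cycle, so all of them are equalities; for the jump of length \<open>r\<close> next to the end, this
  yields equality for each summand in the sum over the frames. The walk \<open>v\<close> with the empty walk at \<open>c\<close> is one of the frames of that jump.\<close>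

lemma card_lower_eq_upper_after_long_walk:
  assumes le: "\<And>a c. card (upper r a c) \<le> card (lower r a c)"
    and ge: "\<And>a c. card (lower (Suc n) a c) \<le> card (upper (Suc n) a c)"
    and v: "length v = n * r" "walk V a v a'"
  shows "card (lower r a' c) = card (upper r a' c)"
proof -
  have "card (zigzags (n * r + r) 0 a c) \<le> card (zigzags (n * r) (r + 0) a c)"
    using zigzags_pull[OF le, where n = 1 and i = "n * r" and m = 0] by simp
  moreover have "card (zigzags (n * r) (r + 0) a c) \<le> card (zigzags 0 (n * r + r) a c)"
    using zigzags_pull[OF le, where n = n and i = 0 and m = r] by simp
  moreover have "card (zigzags 0 (n * r + r) a c) \<le> card (zigzags (n * r + r) 0 a c)"
    using zigzags_push[OF ge, where n = r and i = 0 and m = 0] by (simp add: algebra_simps)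
  ultimately have "card (zigzags (n * r + r) 0 a c) = card (zigzags (n * r) (r + 0) a c)"
    by linarith
  then have eq: "(\<Sum>((v, a'), (w, c'))\<in>frames (n * r) 0 a c. card (upper r a' c')) =
      (\<Sum>((v, a'), (w, c'))\<in>frames (n * r) 0 a c. card (lower r a' c'))"
    unfolding card_zigzags_lower card_zigzags_upper .
  have "((v, a'), ([], c)) \<in> frames (n * r) 0 a c" using v by (simp add: frames_def)
  from sum_mono_inv[OF eq _ this finite_frames] le show ?thesis by (auto simp: case_prod_unfold)
qed

text \<open>An edge into \<open>b'\<close> followed by \<open>w\<close> is a zigzag that crosses at the start, so there is also one
  that crosses at the end.\<close>

lemma walk_transfers_back:
  assumes ge: "\<And>a c. card (lower k a c) \<le> card (upper k a c)"
    and w: "length w = n * k" "walk W b' w b" and b': "b' \<in> Obj W"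
  obtains \<beta> a v where "\<beta> \<in> edges D" "etgt D \<beta> = b" "length v = n * k" "walk V a v (esrc D \<beta>)"
proof -
  obtain \<beta>' where \<beta>': "\<beta>' \<in> edges D" "etgt D \<beta>' = b'"
    using b' valid by (metis imageE valid_transfer_data_def)
  then have "([], \<beta>', w) \<in> zigzags 0 (n * k) (esrc D \<beta>') b" using w by (auto simp: zigzags_def)
  then have "0 < card (zigzags 0 (n * k) (esrc D \<beta>') b)"
    using finite_zigzags card_gt_0_iff by blast
  also have "\<dots> \<le> card (zigzags (n * k) 0 (esrc D \<beta>') b)"
    using zigzags_push[OF ge, where i = 0 and n = n and m = 0] by simp
  finally obtain t where "t \<in> zigzags (n * k) 0 (esrc D \<beta>') b" by (auto simp: card_gt_0_iff)
  then show ?thesis using that by (auto simp: zigzags_def)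
qed

section \<open>The twisted operator\<close>

lemma connecting_edge:
  assumes "connecting_system D S" "is_path W p"
  shows "connecting_edge D S (psrc W p) \<in> edges D"
    "etgt D (connecting_edge D S (psrc W p)) = psrc W p"
proof -
  have "\<exists>!\<beta>. \<beta> \<in> S \<and> etgt D \<beta> = psrc W p" and S: "S \<subseteq> edges D"
    using assms by (auto simp: connecting_system_def)
  from theI'[OF this(1)] S show "connecting_edge D S (psrc W p) \<in> edges D"
    "etgt D (connecting_edge D S (psrc W p)) = psrc W p"
    by (auto simp: connecting_edge_def)
qed

text \<open>Each matrix entry is a finite linear combination of entries of \<open>R z\<close> with coefficients
  independent of \<open>z\<close> and \<open>R\<close>.\<close>

lemma twisted_lhd_entry:
  assumes S: "connecting_system D S" and j: "right_inverse D 2 j ji"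
  shows "\<exists>\<beta>. \<forall>R z. endo V 2 (R z) \<longrightarrow> twisted_lhd D S j ji R z x y =
     (if x \<in> words W 2 \<and> y \<in> words W 2 \<and> wdeg W x = wdeg W y
      then sandwich 2 (esrc D \<beta>) (wtgt W y) j ji (R z) (x, \<beta>) (y, \<beta>) else 0)"
proof (cases "y \<in> words W 2")
  case True
  let ?\<beta> = "connecting_edge D S (wsrc W y)"
  have y: "length y = 2" "walk W (wsrc W y) y (wtgt W y)" using walk_of_word[OF True] by auto
  then have "y \<noteq> []" by auto
  note p = is_path_of_walk[OF y(2) this]
  have \<beta>: "?\<beta> \<in> edges D" "etgt D ?\<beta> = wsrc W y" using connecting_edge[OF S p(1)] p(2) by auto
  then have low: "(y, ?\<beta>) \<in> lower 2 (esrc D ?\<beta>) (wtgt W y)" using y by (auto simp: lower_def)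
  have "twisted D j ji R z ?\<beta> ?\<beta> x y =
      sandwich 2 (esrc D ?\<beta>) (wtgt W y) j ji (R z) (x, ?\<beta>) (y, ?\<beta>)"
    if "endo V 2 (R z)" for R z
    unfolding twisted_def using j \<beta> low ends_preserving_if_endo[OF graded_spaces(1) _ that]
    by (intro circ_op_act_eq_sandwich) (auto simp: right_inverse_def)
  then show ?thesis by (intro exI[of _ ?\<beta>]) (auto simp: twisted_lhd_def lhd_def Let_def)
next
  case False
  then show ?thesis by (simp add: twisted_lhd_def lhd_def)
qed

lemma endo_twisted_lhd: "endo W 2 (twisted_lhd D S j ji R z)"
  by (auto simp: endo_def twisted_lhd_def lhd_def split: if_splits)

lemma ends_preserving_twisted_lhd: "ends_preserving W 2 (twisted_lhd D S j ji R z)"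
  by (intro ends_preserving_if_endo endo_twisted_lhd graded_spaces) simp

lemma meromorphic_twisted_lhd:
  assumes "connecting_system D S" "right_inverse D 2 j ji" "\<And>z. endo V 2 (R z)"
    and "\<And>u v. (\<lambda>z. R z u v) meromorphic_on UNIV"
  shows "(\<lambda>z. twisted_lhd D S j ji R z x y) meromorphic_on UNIV"
proof -
  obtain \<beta> where \<beta>: "\<forall>R z. endo V 2 (R z) \<longrightarrow> twisted_lhd D S j ji R z x y =
     (if x \<in> words W 2 \<and> y \<in> words W 2 \<and> wdeg W x = wdeg W y
      then sandwich 2 (esrc D \<beta>) (wtgt W y) j ji (R z) (x, \<beta>) (y, \<beta>) else 0)"
    using twisted_lhd_entry[OF assms(1,2)] by blast
  show ?thesis unfolding \<beta>[rule_format, of R, OF assms(3)] sandwich_def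
    using assms(4) by (cases "x \<in> words W 2 \<and> y \<in> words W 2 \<and> wdeg W x = wdeg W y")
      (auto intro!: meromorphic_intros)
qed

lemma regular_points_twisted_lhd:
  assumes "connecting_system D S" "right_inverse D 2 j ji" "\<And>z. endo V 2 (R z)"
  shows "regular_points R \<subseteq> regular_points (twisted_lhd D S j ji R)"
proof
  fix z assume "z \<in> regular_points R"
  then have R: "(\<lambda>z. R z u v) analytic_on {z}" for u v by (simp add: regular_points_def)
  have "(\<lambda>z. twisted_lhd D S j ji R z x y) analytic_on {z}" for x y
  proof -
    obtain \<beta> where \<beta>: "\<forall>R z. endo V 2 (R z) \<longrightarrow> twisted_lhd D S j ji R z x y =
       (if x \<in> words W 2 \<and> y \<in> words W 2 \<and> wdeg W x = wdeg W y
        then sandwich 2 (esrc D \<beta>) (wtgt W y) j ji (R z) (x, \<beta>) (y, \<beta>) else 0)"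
      using twisted_lhd_entry[OF assms(1,2)] by blast
    show ?thesis unfolding \<beta>[rule_format, of R, OF assms(3)] sandwich_def
      using R by (cases "x \<in> words W 2 \<and> y \<in> words W 2 \<and> wdeg W x = wdeg W y")
        (auto intro!: analytic_intros)
  qed
  then show "z \<in> regular_points (twisted_lhd D S j ji R)" by (simp add: regular_points_def)
qed

section \<open>The relations at regular arguments of the original operator\<close>

lemma implements_if_weight_zero:
  assumes q: "right_inverse D 3 q qi" and wz: "weight_zero D \<gamma> R1 R2 q qi"
    and z: "z \<in> regular_points R1" and R1: "endo V 2 (R1 z)"
    and \<beta>: "\<beta> \<in> edges D" "etgt D \<beta> = psrc W \<gamma>"
  shows "implements 3 q qi \<beta> (op23 V (R1 z)) (op23 W (R2 z))" (is ?A)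
    and "implements 3 q qi \<beta> (op12 V (R1 z)) (op12 W (R2 z))" (is ?B)
proof -
  have ep: "ends_preserving V 2 (R1 z)" by (rule ends_preserving_if_endo[OF graded_spaces(1) _ R1]) simp
  have Gamma: "q \<in> Gamma_WV D 3" "qi \<in> Gamma_VW D 3" using q by (auto simp: right_inverse_def)
  have *: "sandwich 3 (esrc D \<beta>) c q qi (op23 V (R1 z)) (x, \<beta>') (y, \<beta>) =
        op23 W (R2 z) x y * of_bool (\<beta> = \<beta>') \<and>
      sandwich 3 (esrc D \<beta>) c q qi (op12 V (R1 z)) (x, \<beta>') (y, \<beta>) =
        op12 W (R2 z) x y * of_bool (\<beta> = \<beta>')"
    if y: "(y, \<beta>) \<in> lower 3 (esrc D \<beta>) c" and x: "(x, \<beta>') \<in> lower 3 (esrc D \<beta>) c" for c x y \<beta>'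
  proof -
    have \<beta>': "\<beta>' \<in> edges D" "esrc D \<beta>' = esrc D \<beta>" using x by (auto simp: lower_def)
    have "y \<in> words W 3" "wsrc W y = etgt D \<beta>"
      using y word_of_walk[of W _ y _ 3] by (auto simp: lower_def)
    then have "op23 W (R2 z) x y * of_bool (\<beta> = \<beta>') =
          circ D qi (op_act (op23 V (R1 z)) q) \<beta> \<beta>' x y \<and>
        op12 W (R2 z) x y * of_bool (\<beta> = \<beta>') =
          circ D qi (op_act (op12 V (R1 z)) q) \<beta> \<beta>' x y"
      using wz z \<beta> \<beta>' unfolding weight_zero_def by blast
    then show ?thesis
      using circ_op_act_eq_sandwich[OF Gamma _ ends_preserving_op23[OF ep] y \<beta>'(1), of x]
        circ_op_act_eq_sandwich[OF Gamma _ ends_preserving_op12[OF ep] y \<beta>'(1), of x] by simp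
  qed
  then show ?A ?B by (auto simp: implements_def)
qed

lemma implements_unique:
  assumes "implements m g f \<beta> Q A" "implements m g f \<beta> Q A'" "0 < m"
    and ep: "ends_preserving W m A" "ends_preserving W m A'"
    and \<beta>: "\<beta> \<in> edges D" and y: "length y = m" "walk W (etgt D \<beta>) y c"
  shows "A x y = A' x y"
proof (cases "length x = m \<and> walk W (etgt D \<beta>) x c")
  case True
  then have xy: "(x, \<beta>) \<in> lower m (esrc D \<beta>) c" "(y, \<beta>) \<in> lower m (esrc D \<beta>) c"
    using \<beta> y by (auto simp: lower_def)
  from assms(1)[unfolded implements_def, rule_format, OF xy(2,1)]
    assms(2)[unfolded implements_def, rule_format, OF xy(2,1)]
  show ?thesis by simp
next
  case False
  then have "A x y = 0" "A' x y = 0"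
    using ends_preserving_walk_left[OF _ _ \<open>0 < m\<close> y(2)] ep by blast+
  then show ?thesis by simp
qed

lemma edge_to: "b \<in> Obj W \<Longrightarrow> \<exists>\<beta>\<in>edges D. etgt D \<beta> = b"
  using valid unfolding valid_transfer_data_def by (metis imageE)

lemma braid_relation_if_weight_zero:
  assumes q: "right_inverse D 3 q qi" and wz: "weight_zero D \<gamma> R1 R2 q qi"
    and reg: "{z, w, z - w} \<subseteq> regular_points R1" and R1: "\<And>z. endo V 2 (R1 z)"
    and R2: "\<And>z. ends_preserving W 2 (R2 z)"
    and ybe: "op23 V (R1 (z - w)) \<odot> op12 V (R1 z) \<odot> op23 V (R1 w) =
        op12 V (R1 w) \<odot> op23 V (R1 z) \<odot> op12 V (R1 (z - w))"
    and y: "length y = 3" "walk W (psrc W \<gamma>) y c"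
  shows "(op23 W (R2 (z - w)) \<odot> op12 W (R2 z) \<odot> op23 W (R2 w)) x y =
        (op12 W (R2 w) \<odot> op23 W (R2 z) \<odot> op12 W (R2 (z - w))) x y"
proof -
  have "y \<noteq> []" using y by auto
  then have "psrc W \<gamma> \<in> Obj W" using walk_objects[OF graded_spaces(3) y(2)] by simp
  then obtain \<beta> where \<beta>: "\<beta> \<in> edges D" "etgt D \<beta> = psrc W \<gamma>" using edge_to by blast
  have ep: "ends_preserving V 2 (R1 u)" for u
    by (rule ends_preserving_if_endo[OF graded_spaces(1) _ R1]) simp
  note imp = implements_if_weight_zero[OF q wz _ R1 \<beta>]
  note ops = ends_preserving_op12[OF ep] ends_preserving_op23[OF ep]
    ends_preserving_op12[OF R2] ends_preserving_op23[OF R2]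
  have "implements 3 q qi \<beta>
      (op23 V (R1 (z - w)) \<odot> op12 V (R1 z) \<odot> op23 V (R1 w))
      (op23 W (R2 (z - w)) \<odot> op12 W (R2 z) \<odot> op23 W (R2 w))"
    using reg by (intro implements_mmul[OF q] imp ops) auto
  moreover have "implements 3 q qi \<beta>
      (op12 V (R1 w) \<odot> op23 V (R1 z) \<odot> op12 V (R1 (z - w)))
      (op12 W (R2 w) \<odot> op23 W (R2 z) \<odot> op12 W (R2 (z - w)))"
    using reg by (intro implements_mmul[OF q] imp ops) auto
  ultimately show ?thesis
    using y \<beta> unfolding ybe
    by (elim implements_unique[where c = c]) (auto intro!: ends_preserving_mmul ops)
qed

text \<open>Quasi-uniqueness applies to every path, in particular to the last arrow of the path that it
  has just supplied, so extension to the left never stops.\<close>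

lemma quasi_unique_extends_back:
  assumes "quasi_unique D S" "is_path W p"
  shows "\<exists>b x. length x = n \<and> walk W b x (psrc W p)"
  using assms(2)
proof (induction n arbitrary: p)
  case (Suc n)
  obtain p' where p': "is_path W p'" "ptgt W p' = psrc W p"
    using assms(1) Suc.prems by (auto simp: quasi_unique_def quasi_unique_at_def)
  let ?\<alpha> = "last p'"
  have \<alpha>: "?\<alpha> \<in> Arr W" "vdim W ?\<alpha> \<noteq> 0"
    using p'(1) last_in_set[of p'] unfolding is_path_def by blast+
  then have "is_path W [?\<alpha>]" by (simp add: is_path_def)
  from Suc.IH[OF this] obtain b x where x: "length x = n" "walk W b x (src W ?\<alpha>)"
    by (auto simp: psrc_def)
  have "length (x @ [(?\<alpha>, 0)]) = Suc n \<and> walk W b (x @ [(?\<alpha>, 0)]) (psrc W p)"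
    using x \<alpha> p'(2) by (auto simp: walk_append ptgt_def)
  then show ?case by blast
qed auto

text \<open>The edge at which the weight zero condition is used must start at an object that is reached by
  a long walk. A walk of length \<open>3 k\<close> into the source of \<open>\<gamma>\<close> provides such an edge, and dropping
  the first three letters of the transferred walk leaves exactly the length \<open>3 (k - 1)\<close> for which the
  counting argument makes the blocks square.\<close>

lemma inversion_if_weight_zero:
  assumes q: "right_inverse D 3 q qi" and wz: "weight_zero D \<gamma> R1 R2 q qi"
    and \<gamma>: "is_path W \<gamma>" and qu: "quasi_unique D S"
    and q1: "left_inverse D k q1 q1i" "0 < k"
    and reg: "{z, - z} \<subseteq> regular_points R1" and R1: "\<And>z. endo V 2 (R1 z)"
    and R2: "\<And>z. ends_preserving W 2 (R2 z)"
    and inv: "mmul (R1 z) (R1 (- z)) = idm V 2"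
    and y: "length y = 3" "walk W (psrc W \<gamma>) y c"
  shows "op23 W (mmul (R2 z) (R2 (- z))) x y = op23 W (idm W 2) x y"
proof -
  obtain n where n: "k = Suc n" using q1(2) gr0_implies_Suc by blast
  have le: "card (upper 3 a c) \<le> card (lower 3 a c)" for a c
    by (rule card_upper_le_lower[OF q]) simp
  have ge: "card (lower (Suc n) a c) \<le> card (upper (Suc n) a c)" for a c
    using card_lower_le_upper[OF q1] by (simp add: n)
  obtain b' x' where x': "length x' = 3 * Suc n" "walk W b' x' (psrc W \<gamma>)"
    using quasi_unique_extends_back[OF qu \<gamma>] by blast
  then have "x' \<noteq> []" by auto
  with x'(2) have "b' \<in> Obj W" by (rule walk_objects(1)[OF graded_spaces(3)])
  from walk_transfers_back[OF ge x' this] obtain \<beta> a v where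
    \<beta>: "\<beta> \<in> edges D" "etgt D \<beta> = psrc W \<gamma>" and
    v: "length v = 3 * Suc n" "walk V a v (esrc D \<beta>)" by blast
  have "walk V a (take 3 v @ drop 3 v) (esrc D \<beta>)" using v by simp
  then obtain a' where a': "walk V a' (drop 3 v) (esrc D \<beta>)" unfolding walk_append by blast
  have "length (drop 3 v) = n * 3" using v by simp
  from card_lower_eq_upper_after_long_walk[OF le ge this a']
  have card: "card (lower 3 (esrc D \<beta>) c) = card (upper 3 (esrc D \<beta>) c)" for c .
  have ep: "ends_preserving V 2 (R1 u)" for u
    by (rule ends_preserving_if_endo[OF graded_spaces(1) _ R1]) simp
  note imp = implements_if_weight_zero(1)[OF q wz _ R1 \<beta>]
  have "implements 3 q qi \<beta> (mmul (op23 V (R1 z)) (op23 V (R1 (- z))))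
      (mmul (op23 W (R2 z)) (op23 W (R2 (- z))))"
    using reg by (intro implements_mmul[OF q] imp ends_preserving_op23 ep R2) auto
  then have "implements 3 q qi \<beta> (idm V 3) (op23 W (mmul (R2 z) (R2 (- z))))"
    by (simp add: op23_mmul ep R2 inv op23_idm)
  moreover have "implements 3 q qi \<beta> (idm V 3) (op23 W (idm W 2))"
    unfolding op23_idm by (rule implements_idm[OF q]) (simp_all add: card)
  ultimately show ?thesis
    using y \<beta>
    by (elim implements_unique[where c = c])
      (auto intro!: ends_preserving_op23 ends_preserving_mmul ends_preserving_idm R2)
qed

end

section \<open>Passage to the limit\<close>

lemma isCont_eq_if_eventually_eq:
  fixes f g :: "complex \<Rightarrow> complex"
  assumes "isCont f a" "isCont g a" "eventually (\<lambda>t. f t = g t) (at a)"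
  shows "f a = g a"
proof -
  have "(f \<longlongrightarrow> f a) (at a)" "(g \<longlongrightarrow> g a) (at a)"
    using assms(1,2) by (simp_all add: isCont_def)
  moreover from this(1) have "(g \<longlongrightarrow> f a) (at a)"
    using assms(3) by (rule Lim_transform_eventually)
  ultimately show ?thesis by (intro tendsto_unique[of "at a"]) auto
qed

lemma eventually_regular:
  assumes "(- P) sparse_in UNIV" "c \<noteq> (0 :: complex)"
  shows "eventually (\<lambda>t. z + c * t \<in> P) (at 0)"
proof -
  have "\<not> z islimpt - P" using assms(1) by (simp add: sparse_in_open)
  then have "eventually (\<lambda>u. u \<in> P) (at z)" by (simp add: islimpt_iff_eventually)
  moreover have "filterlim (\<lambda>t. z + c * t) (at z) (at 0)"
    unfolding filterlim_at
  proof
    show "eventually (\<lambda>t. z + c * t \<in> UNIV \<and> z + c * t \<noteq> z) (at 0)"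
      using assms(2) by (auto simp: eventually_at_filter)
    show "((\<lambda>t. z + c * t) \<longlongrightarrow> z) (at 0)" by (auto intro!: tendsto_eq_intros)
  qed
  ultimately show ?thesis by (rule eventually_compose_filterlim)
qed

lemma isCont_regular_affine:
  assumes "z \<in> regular_points R"
  shows "isCont (\<lambda>t. R (z + c * t) x y) 0"
proof -
  have "isCont (\<lambda>u. R u x y) z"
    using assms by (auto simp: regular_points_def intro: analytic_at_imp_isCont)
  moreover have "isCont (\<lambda>t. z + c * t) 0" by (intro continuous_intros)
  ultimately show ?thesis using isCont_o2[of 0 "\<lambda>t. z + c * t" "\<lambda>u. R u x y"] by simp
qed

lemma isCont_mmul:
  assumes V: "groupoid V" "finite_type V" and "0 < m" and B: "\<And>t. ends_preserving V m (B t)"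
    and "\<And>x y. isCont (\<lambda>t. A t x y) s" "\<And>x y. isCont (\<lambda>t. B t x y) s"
  shows "isCont (\<lambda>t. mmul (A t) (B t) x z) s"
proof (cases "\<exists>a b. length z = m \<and> walk V a z b")
  case True
  then obtain a b where z: "length z = m" "walk V a z b" by blast
  let ?N = "{y. length y = m \<and> (\<exists>b. walk V a y b)}"
  have "mmul (A t) (B t) x z = (\<Sum>y\<in>?N. A t x y * B t y z)" for t
    by (rule mmul_eq_sum_over_walks[OF B \<open>0 < m\<close> z(2) finite_walks_from[OF V]]) auto
  then show ?thesis using assms(5,6) by (simp add: continuous_intros)
next
  case False
  have "B t y z = 0" for t y
    using False by (intro ends_preserving_zero[OF B])
  then show ?thesis by (simp add: mmul_def)
qed

lemma isCont_op12:
  assumes "\<And>x y. isCont (\<lambda>t. A t x y) s"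
  shows "isCont (\<lambda>t. op12 V (A t) x y) s"
  unfolding op12_def tens_def
  by (cases "joins V 2 x \<and> joins V 2 y") (auto intro!: continuous_intros assms)

lemma isCont_op23:
  assumes "\<And>x y. isCont (\<lambda>t. A t x y) s"
  shows "isCont (\<lambda>t. op23 V (A t) x y) s"
  unfolding op23_def tens_def
  by (cases "joins V 1 x \<and> joins V 1 y") (auto intro!: continuous_intros assms)

section \<open>The twist of a Yang--Baxter operator\<close>

theorem proposition4p12:
  fixes D :: "('o, 'a, 'q, 'b, 'p) transfer_data"
    and S :: "'p set"
    and R1 :: "complex \<Rightarrow> ('a, 'a) mat"
    and j :: "'p \<Rightarrow> 'p \<Rightarrow> ('a, 'b) mat"
    and j_inv :: "'p \<Rightarrow> 'p \<Rightarrow> ('b, 'a) mat"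
  assumes "valid_transfer_data D"
    and "yang_baxter (sp1 D) R1"
    and "connecting_system D S"
    and "j \<in> Gamma_WV D 2"
    and "right_inverse D 2 j j_inv"
    and "quasi_unique D S"
    and "no_multi_edge D"
    and "is_twist D S R1 j j_inv"
  shows "yang_baxter (sp2 D) (twisted_lhd D S j j_inv R1)"
proof -
  interpret transfer D using assms(1,7) by unfold_locales
  let ?R2 = "twisted_lhd D S j j_inv R1"
  have R1: "\<And>z. endo V 2 (R1 z)" "\<And>x y. (\<lambda>z. R1 z x y) meromorphic_on UNIV"
      "(- regular_points R1) sparse_in UNIV"
      "\<And>z w. {z, w, z - w} \<subseteq> regular_points R1 \<Longrightarrow>
        op23 V (R1 (z - w)) \<odot> op12 V (R1 z) \<odot> op23 V (R1 w) =
        op12 V (R1 w) \<odot> op23 V (R1 z) \<odot> op12 V (R1 (z - w))"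
      "\<And>z. {z, - z} \<subseteq> regular_points R1 \<Longrightarrow> mmul (R1 z) (R1 (- z)) = idm V 2"
    using assms(2) unfolding yang_baxter_def by auto
  note R2 = ends_preserving_twisted_lhd[of S j j_inv R1]
  have twist: "\<exists>k q qi q1 q1i. 0 < k \<and> right_inverse D 3 q qi \<and> weight_zero D \<gamma> R1 ?R2 q qi \<and>
      left_inverse D k q1 q1i"
    if "is_path W \<gamma>" "length \<gamma> = 3" for \<gamma>
  proof -
    from assms(8) that have "\<exists>\<gamma>'. quasi_unique_at D S \<gamma> \<gamma>' \<and>
        (\<exists>q2 q2i. right_inverse D 3 q2 q2i \<and> weight_zero D \<gamma> R1 ?R2 q2 q2i \<and>
          (\<exists>q1 q1i. left_inverse D (length \<gamma>') q1 q1i))"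
      unfolding is_twist_def by meson
    then obtain \<gamma>' q2 q2i q1 q1i where "quasi_unique_at D S \<gamma> \<gamma>'" "right_inverse D 3 q2 q2i"
      "weight_zero D \<gamma> R1 ?R2 q2 q2i"
      "left_inverse D (length \<gamma>') q1 q1i"
      by blast
    moreover from this(1) have "0 < length \<gamma>'" by (simp add: quasi_unique_at_def is_path_def)
    ultimately show ?thesis by blast
  qed
  have braid: "op23 W (?R2 (z - w)) \<odot> op12 W (?R2 z) \<odot> op23 W (?R2 w) =
      op12 W (?R2 w) \<odot> op23 W (?R2 z) \<odot> op12 W (?R2 (z - w))" (is "?L = ?M")
    if reg: "{z, w, z - w} \<subseteq> regular_points R1" for z w
  proof (intro ext)
    fix x y
    have ep: "ends_preserving W 3 ?L" "ends_preserving W 3 ?M"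
      by (auto intro!: ends_preserving_mmul ends_preserving_op12 ends_preserving_op23 R2)
    show "?L x y = ?M x y"
    proof (cases "\<exists>b c. length y = 3 \<and> walk W b y c")
      case True
      then obtain b c where y: "length y = 3" "walk W b y c" by blast
      then have "y \<noteq> []" by auto
      note p = is_path_of_walk[OF y(2) this]
      obtain q qi where "right_inverse D 3 q qi" "weight_zero D (map fst y) R1 ?R2 q qi"
        using twist[OF p(1)] y(1) by auto
      from braid_relation_if_weight_zero[OF this reg R1(1) R2 R1(4)[OF reg], of y c x]
      show ?thesis using y p(2) by simp
    next
      case False
      then show ?thesis using ep[THEN ends_preserving_zero] by simp
    qed
  qed
  have inversion: "mmul (?R2 z) (?R2 (- z)) = idm W 2"
    if reg: "{z, - z} \<subseteq> regular_points R1" for z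
  proof (intro ext)
    fix x y
    have ep: "ends_preserving W 2 (mmul (?R2 z) (?R2 (- z)))" "ends_preserving W 2 (idm W 2)"
      by (auto intro!: ends_preserving_mmul ends_preserving_idm R2)
    show "mmul (?R2 z) (?R2 (- z)) x y = idm W 2 x y"
    proof (cases "\<exists>b c. length x = 2 \<and> walk W b x c \<and> length y = 2 \<and> walk W b y c")
      case True
      then obtain b c where x: "length x = 2" "walk W b x c" and y: "length y = 2" "walk W b y c"
        by blast
      then have "y \<noteq> []" by auto
      note p = is_path_of_walk[OF y(2) this]
      \<comment> \<open>the weight zero condition concerns words of length 3: prefix a letter to \<open>x\<close> and \<open>y\<close>\<close>
      obtain b' h' where h': "length h' = 1" "walk W b' h' b"
        using quasi_unique_extends_back[OF assms(6) p(1), of 1] p(2) by auto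
      then obtain h where h: "walk W b' [h] b" by (cases h') auto
      have hy: "walk W b' (h # y) c" using h y by auto
      note hp = is_path_of_walk[OF hy, simplified]
      obtain k q qi q1 q1i where tw: "right_inverse D 3 q qi"
        "weight_zero D (map fst (h # y)) R1 ?R2 q qi"
        and q1: "left_inverse D k q1 q1i" "0 < k"
        using twist[of "map fst (h # y)"] hp y(1) by auto
      have "op23 W (mmul (?R2 z) (?R2 (- z))) (h # x) (h # y) = op23 W (idm W 2) (h # x) (h # y)"
        by (rule inversion_if_weight_zero[OF tw _ assms(6) q1 reg R1(1) R2 R1(5)[OF reg],
              where c = c])
          (use hp hy y in auto)
      then show ?thesis
        using op23_Cons[OF ep(1) h x(2) y(2) x(1) y(1)] op23_Cons[OF ep(2) h x(2) y(2) x(1) y(1)]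
        by simp
    next
      case False
      then show ?thesis using ep unfolding ends_preserving_def by metis
    qed
  qed
  note cont = isCont_regular_affine[where R = ?R2]
  note sparse = eventually_regular[OF R1(3)]
  show ?thesis
    unfolding yang_baxter_def
  proof (intro conjI allI impI)
    show "endo W 2 (?R2 z)" for z by (rule endo_twisted_lhd)
    show "(\<lambda>z. ?R2 z x y) meromorphic_on UNIV" for x y
      by (rule meromorphic_twisted_lhd[OF assms(3,5) R1(1,2)])
    show "(- regular_points ?R2) sparse_in UNIV"
      using regular_points_twisted_lhd[OF assms(3,5) R1(1)]
      by (intro sparse_in_subset2[OF R1(3)]) auto
  next
    fix z w
    assume reg: "z \<in> regular_points ?R2" "w \<in> regular_points ?R2" "z - w \<in> regular_points ?R2"
    show "op23 W (?R2 (z - w)) \<odot> op12 W (?R2 z) \<odot> op23 W (?R2 w) =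
      op12 W (?R2 w) \<odot> op23 W (?R2 z) \<odot> op12 W (?R2 (z - w))"
    proof (intro ext)
      fix x y
      \<comment> \<open>Perturb the arguments along a line on which \<open>z\<close>, \<open>w\<close> and \<open>z - w\<close> all move, with nonzero
        speeds 1, -1 and 2, so that all three avoid the poles of \<open>R1\<close> for small nonzero \<open>t\<close>.\<close>
      define A B C where "A = (\<lambda>t. ?R2 (z - w + 2 * t))" and "B = (\<lambda>t. ?R2 (z + 1 * t))"
        and "C = (\<lambda>t. ?R2 (w + (- 1) * t))"
      have c: "isCont (\<lambda>t. A t x y) 0" "isCont (\<lambda>t. B t x y) 0" "isCont (\<lambda>t. C t x y) 0" for x y
        unfolding A_def B_def C_def by (intro cont reg)+
      have ep: "ends_preserving W 2 (A t)" "ends_preserving W 2 (B t)" "ends_preserving W 2 (C t)"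
        for t unfolding A_def B_def C_def by (rule R2)+
      have "eventually (\<lambda>t. z - w + 2 * t \<in> regular_points R1 \<and> z + 1 * t \<in> regular_points R1 \<and>
          w + (- 1) * t \<in> regular_points R1) (at 0)"
        by (intro eventually_conj sparse) auto
      then have "eventually (\<lambda>t. (op23 W (A t) \<odot> op12 W (B t) \<odot> op23 W (C t)) x y =
          (op12 W (C t) \<odot> op23 W (B t) \<odot> op12 W (A t)) x y) (at 0)"
      proof (rule eventually_mono)
        fix t
        have diff: "z + 1 * t - (w + (- 1) * t) = z - w + 2 * t" by simp
        assume "z - w + 2 * t \<in> regular_points R1 \<and> z + 1 * t \<in> regular_points R1 \<and>
          w + (- 1) * t \<in> regular_points R1"
        then have "{z + 1 * t, w + (- 1) * t, z + 1 * t - (w + (- 1) * t)} \<subseteq> regular_points R1"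
          unfolding diff by blast
        from fun_cong[OF fun_cong[OF braid[OF this]]]
        show "(op23 W (A t) \<odot> op12 W (B t) \<odot> op23 W (C t)) x y =
          (op12 W (C t) \<odot> op23 W (B t) \<odot> op12 W (A t)) x y"
          unfolding A_def B_def C_def diff .
      qed
      moreover have "isCont (\<lambda>t. (op23 W (A t) \<odot> op12 W (B t) \<odot> op23 W (C t)) x y) 0"
          "isCont (\<lambda>t. (op12 W (C t) \<odot> op23 W (B t) \<odot> op12 W (A t)) x y) 0"
        by (intro isCont_mmul[OF graded_spaces(3,4), where m = 3] isCont_op12 isCont_op23 c
            ends_preserving_op12 ends_preserving_op23 ep; simp)+
      ultimately have "(op23 W (A 0) \<odot> op12 W (B 0) \<odot> op23 W (C 0)) x y =
          (op12 W (C 0) \<odot> op23 W (B 0) \<odot> op12 W (A 0)) x y"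
        by (intro isCont_eq_if_eventually_eq)
      then show "(op23 W (?R2 (z - w)) \<odot> op12 W (?R2 z) \<odot> op23 W (?R2 w)) x y =
        (op12 W (?R2 w) \<odot> op23 W (?R2 z) \<odot> op12 W (?R2 (z - w))) x y"
        by (simp add: A_def B_def C_def)
    qed
  next
    fix z
    assume reg: "z \<in> regular_points ?R2" "- z \<in> regular_points ?R2"
    show "mmul (?R2 z) (?R2 (- z)) = idm W 2"
    proof (intro ext)
      fix x y
      define A B where "A = (\<lambda>t. ?R2 (z + 1 * t))" and "B = (\<lambda>t. ?R2 (- z + (- 1) * t))"
      have c: "isCont (\<lambda>t. A t x y) 0" "isCont (\<lambda>t. B t x y) 0" for x y
        unfolding A_def B_def by (intro cont reg)+
      have ep: "ends_preserving W 2 (B t)" for t unfolding B_def by (rule R2)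
      have "eventually (\<lambda>t. z + 1 * t \<in> regular_points R1 \<and>
          - z + (- 1) * t \<in> regular_points R1) (at 0)"
        by (intro eventually_conj sparse) auto
      then have "eventually (\<lambda>t. mmul (A t) (B t) x y = idm W 2 x y) (at 0)"
      proof (rule eventually_mono)
        fix t
        have "- z + (- 1) * t = - (z + 1 * t)" by simp
        moreover assume "z + 1 * t \<in> regular_points R1 \<and> - z + (- 1) * t \<in> regular_points R1"
        ultimately show "mmul (A t) (B t) x y = idm W 2 x y"
          unfolding A_def B_def using inversion[of "z + 1 * t"] by simp
      qed
      moreover have "isCont (\<lambda>t. mmul (A t) (B t) x y) 0"
        by (intro isCont_mmul[OF graded_spaces(3,4), where m = 2] c ep) simp
      ultimately have "mmul (A 0) (B 0) x y = idm W 2 x y"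
        by (intro isCont_eq_if_eventually_eq[where g = "\<lambda>_. idm W 2 x y"]) auto
      then show "mmul (?R2 z) (?R2 (- z)) x y = idm W 2 x y"
        by (simp add: A_def B_def)
    qed
  qed
qed

end
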